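(* The following statements are equivalent for all cardinals $\kappa\leq\lambda$: (i) $\kappa$ is $\lambda$-supercompact. (ii) For all sufficiently large cardinals $\theta$, there is a small embedding $j:M\longrightarrow \mathrm{H}(\theta)$ for $\kappa$ and $\delta\in M\cap\kappa$ such that $j(\delta)=\lambda$ and $$\{A\in\mathcal{P}(\mathcal{P}_{\mathrm{crit}(j)}(\delta))^M\mid j[\delta]\in j(A)\}\ \in\ M.$$
   Context: $\mathrm{H}(\theta)$ is the set of all sets whose transitive closure has cardinality less than $\theta$. An elementary embedding $j:M\to N$ between transitive classes is non-trivial if there is an ordinal $\alpha\in M$ with $j(\alpha)>\alpha$; then $\mathrm{crit}(j)$ denotes the least such ordinal. Given cardinals $\kappa<\theta$, a non-trivial elementary embedding $j:M\to \mathrm{H}(\theta)$ is a small embedding for $\kappa$ if $M\in \mathrm{H}(\theta)$ is transitive and $j(\mathrm{crit}(j))=\kappa$. "For all sufficiently large cardinals $\theta$" means: there is an ordinal $\alpha\geq\kappa$ such that the statement holds for all cardinals $\theta>\alpha$. $\mathcal{P}_\nu(\delta)$ is the set of all subsets of $\delta$ of cardinality less than $\nu$, and $j[\delta]=\{j(\gamma)\mid\gamma<\delta\}$. An uncountable cardinal $\kappa$ is $\lambda$-supercompact if there is a ($\kappa$-complete, fine) normal ultrafilter on $\mathcal{P}_\kappa(\lambda)$. *)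

theory Defs
  imports "HOL-Library.Equipollence" "HOL-Library.Countable_Set"
begin

text \<open>
  The ambient universe of sets is a type whose membership relation satisfies the axioms of ZFC, with
  separation and replacement stated for arbitrary predicates and functions of the logic. The axiom
  of choice is inherited from Hilbert choice. Consequently a subset of, or a function on,
  \<open>elts x\<close> at the level of the logic is always represented by an element of the universe, so
  the notions below may use the set-theoretic vocabulary of the library. Classes of the universe
  are values of type \<open>'v set\<close>.
\<close>

class zfc_universe =
  fixes elts :: "'a \<Rightarrow> 'a set"
  assumes extensionality: "elts x = elts y \<Longrightarrow> x = y"
    and foundation: "wf {(x, y). x \<in> elts y}"
    and pairing: "\<exists>z. elts z = {x, y}"
    and union: "\<exists>z. elts z = (\<Union>y\<in>elts x. elts y)"
    and power_set: "\<exists>z. elts z = {y. elts y \<subseteq> elts x}"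
    and infinity: "\<exists>w. (\<exists>z\<in>elts w. elts z = {}) \<and> (\<forall>x\<in>elts w. \<exists>y\<in>elts w. elts y = insert x (elts x))"
    and separation: "\<exists>z. elts z = {y \<in> elts x. P y}"
    and replacement: "\<exists>z. elts z = f ` elts x"

definition Transset :: "'v::zfc_universe \<Rightarrow> bool" where
  "Transset x \<longleftrightarrow> (\<forall>y\<in>elts x. elts y \<subseteq> elts x)"

text \<open>Ordinals are von Neumann ordinals: \<open>\<alpha> < \<beta>\<close> is \<open>\<alpha> \<in> elts \<beta>\<close>, and
  \<open>\<alpha> \<le> \<beta>\<close> is \<open>elts \<alpha> \<subseteq> elts \<beta>\<close>.\<close>

definition Ord :: "'v::zfc_universe \<Rightarrow> bool" where
  "Ord \<alpha> \<longleftrightarrow> Transset \<alpha> \<and> (\<forall>\<beta>\<in>elts \<alpha>. Transset \<beta>)"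

definition Card :: "'v::zfc_universe \<Rightarrow> bool" where
  "Card \<kappa> \<longleftrightarrow> Ord \<kappa> \<and> (\<forall>\<beta>\<in>elts \<kappa>. \<not> elts \<beta> \<approx> elts \<kappa>)"

text \<open>\<open>X\<close> has cardinality less than the ordinal \<open>\<nu>\<close>.\<close>

definition card_less :: "'b set \<Rightarrow> 'v::zfc_universe \<Rightarrow> bool" where
  "card_less X \<nu> \<longleftrightarrow> (\<exists>\<beta>\<in>elts \<nu>. X \<approx> elts \<beta>)"

definition trcl :: "'v::zfc_universe \<Rightarrow> 'v set" where
  "trcl x = {y. (y, x) \<in> {(u, v). u \<in> elts v}\<^sup>+}"

definition Hset :: "'v::zfc_universe \<Rightarrow> 'v set" where
  "Hset \<theta> = {x. card_less (trcl x) \<theta>}"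

definition Pset :: "'v::zfc_universe \<Rightarrow> 'v \<Rightarrow> 'v set" where
  "Pset \<nu> \<delta> = {a. elts a \<subseteq> elts \<delta> \<and> card_less (elts a) \<nu>}"


section \<open>Supercompactness\<close>

definition ultrafilter_on :: "'b set \<Rightarrow> 'b set set \<Rightarrow> bool" where
  "ultrafilter_on S U \<longleftrightarrow>
     U \<subseteq> Pow S \<and> S \<in> U \<and> {} \<notin> U \<and>
     (\<forall>X\<in>U. \<forall>Y\<in>U. X \<inter> Y \<in> U) \<and>
     (\<forall>X\<in>U. \<forall>Y. X \<subseteq> Y \<and> Y \<subseteq> S \<longrightarrow> Y \<in> U) \<and>
     (\<forall>X. X \<subseteq> S \<longrightarrow> X \<in> U \<or> S - X \<in> U)"

definition complete_family :: "'v::zfc_universe \<Rightarrow> 'b set set \<Rightarrow> bool" where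
  "complete_family \<kappa> U \<longleftrightarrow> (\<forall>F. F \<subseteq> U \<and> F \<noteq> {} \<and> card_less F \<kappa> \<longrightarrow> \<Inter>F \<in> U)"

definition fine_family :: "'v::zfc_universe \<Rightarrow> 'v \<Rightarrow> 'v set set \<Rightarrow> bool" where
  "fine_family \<kappa> \<mu> U \<longleftrightarrow> (\<forall>\<gamma>\<in>elts \<mu>. {a \<in> Pset \<kappa> \<mu>. \<gamma> \<in> elts a} \<in> U)"

text \<open>Normality: every function regressive on a set in \<open>U\<close> is constant on a set in \<open>U\<close>.\<close>

definition normal_family :: "'v::zfc_universe \<Rightarrow> 'v \<Rightarrow> 'v set set \<Rightarrow> bool" where
  "normal_family \<kappa> \<mu> U \<longleftrightarrow>
     (\<forall>f. {a \<in> Pset \<kappa> \<mu>. f a \<in> elts a} \<in> U \<longrightarrow>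
        (\<exists>\<gamma>\<in>elts \<mu>. {a \<in> Pset \<kappa> \<mu>. f a = \<gamma>} \<in> U))"

definition supercompact :: "'v::zfc_universe \<Rightarrow> 'v \<Rightarrow> bool" where
  "supercompact \<kappa> \<mu> \<longleftrightarrow>
     Card \<kappa> \<and> uncountable (elts \<kappa>) \<and>
     (\<exists>U. ultrafilter_on (Pset \<kappa> \<mu>) U \<and> complete_family \<kappa> U \<and>
          fine_family \<kappa> \<mu> U \<and> normal_family \<kappa> \<mu> U)"


section \<open>Elementary embeddings\<close>

text \<open>First-order formulas of the language of set theory, with named variables \<open>0, 1, 2, \<dots>\<close>.\<close>

datatype fm = Member nat nat | Equal nat nat | Neg fm | Conj fm fm | Forall nat fm

primrec satisfies :: "'v::zfc_universe set \<Rightarrow> fm \<Rightarrow> (nat \<Rightarrow> 'v) \<Rightarrow> bool" where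
  "satisfies N (Member m n) s \<longleftrightarrow> s m \<in> elts (s n)"
| "satisfies N (Equal m n) s \<longleftrightarrow> s m = s n"
| "satisfies N (Neg \<phi>) s \<longleftrightarrow> \<not> satisfies N \<phi> s"
| "satisfies N (Conj \<phi> \<psi>) s \<longleftrightarrow> satisfies N \<phi> s \<and> satisfies N \<psi> s"
| "satisfies N (Forall n \<phi>) s \<longleftrightarrow> (\<forall>x\<in>N. satisfies N \<phi> (s(n := x)))"

text \<open>Embeddings are total functions of the logic; only their values on the domain matter.\<close>

definition elementary_embedding :: "('v::zfc_universe \<Rightarrow> 'v) \<Rightarrow> 'v set \<Rightarrow> 'v set \<Rightarrow> bool" where
  "elementary_embedding j M N \<longleftrightarrow>
     j ` M \<subseteq> N \<and>
     (\<forall>\<phi> s. range s \<subseteq> M \<longrightarrow> satisfies M \<phi> s = satisfies N \<phi> (j \<circ> s))"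

definition nontrivial :: "('v::zfc_universe \<Rightarrow> 'v) \<Rightarrow> 'v set \<Rightarrow> bool" where
  "nontrivial j M \<longleftrightarrow> (\<exists>\<alpha>\<in>M. Ord \<alpha> \<and> \<alpha> \<in> elts (j \<alpha>))"

definition crit :: "('v::zfc_universe \<Rightarrow> 'v) \<Rightarrow> 'v set \<Rightarrow> 'v" where
  "crit j M = (THE \<alpha>. \<alpha> \<in> M \<and> Ord \<alpha> \<and> \<alpha> \<in> elts (j \<alpha>) \<and>
     (\<forall>\<beta>\<in>M. Ord \<beta> \<and> \<beta> \<in> elts (j \<beta>) \<longrightarrow> elts \<alpha> \<subseteq> elts \<beta>))"

definition small_embedding ::
  "'v::zfc_universe \<Rightarrow> 'v \<Rightarrow> 'v \<Rightarrow> ('v \<Rightarrow> 'v) \<Rightarrow> bool" where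
  "small_embedding \<kappa> \<theta> M j \<longleftrightarrow>
     Card \<kappa> \<and> Card \<theta> \<and> \<kappa> \<in> elts \<theta> \<and>
     M \<in> Hset \<theta> \<and> Transset M \<and>
     elementary_embedding j (elts M) (Hset \<theta>) \<and>
     nontrivial j (elts M) \<and> j (crit j (elts M)) = \<kappa>"


section \<open>Relativization to a transitive class\<close>

definition vset :: "'v::zfc_universe set \<Rightarrow> 'v" where
  "vset X = (THE x. elts x = X)"

definition kpair :: "'v::zfc_universe \<Rightarrow> 'v \<Rightarrow> 'v" where
  "kpair x y = vset {vset {x}, vset {x, y}}"

definition bijection_set :: "'v::zfc_universe \<Rightarrow> 'v \<Rightarrow> 'v \<Rightarrow> bool" where
  "bijection_set f x y \<longleftrightarrow>
     (\<exists>g. bij_betw g (elts x) (elts y) \<and> elts f = (\<lambda>u. kpair u (g u)) ` elts x)"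

text \<open>
  The classes \<open>P\<^sub>\<nu>(\<delta>)\<^sup>N\<close> and \<open>P(P\<^sub>\<nu>(\<delta>))\<^sup>N\<close>, for a transitive class \<open>N\<close> that has \<open>\<nu>\<close> and
  \<open>\<delta>\<close> as elements. The bijection witnessing that a subset of \<open>\<delta>\<close> has cardinality less than \<open>\<nu>\<close>
  must itself be an element of \<open>N\<close>; the remaining parts of the definition are absolute
  for \<open>N\<close>.
\<close>

definition Pset_rel :: "'v::zfc_universe set \<Rightarrow> 'v \<Rightarrow> 'v \<Rightarrow> 'v set" where
  "Pset_rel N \<nu> \<delta> =
     {a \<in> N. elts a \<subseteq> elts \<delta> \<and> (\<exists>\<beta>\<in>elts \<nu>. \<exists>f\<in>N. bijection_set f a \<beta>)}"

definition PowPset_rel :: "'v::zfc_universe set \<Rightarrow> 'v \<Rightarrow> 'v \<Rightarrow> 'v set" where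
  "PowPset_rel N \<nu> \<delta> = {A \<in> N. elts A \<subseteq> Pset_rel N \<nu> \<delta>}"

text \<open>
  The family \<open>{A \<in> P(P\<^sub>c\<^sub>r\<^sub>i\<^sub>t\<^sub>(\<^sub>j\<^sub>)(\<delta>))\<^sup>M. j[\<delta>] \<in> j(A)}\<close>. A set \<open>X\<close> of the logic
  is an element of the set \<open>y\<close> iff \<open>X \<in> elts ` elts y\<close>.
\<close>

definition derived_family :: "('v::zfc_universe \<Rightarrow> 'v) \<Rightarrow> 'v \<Rightarrow> 'v \<Rightarrow> 'v set" where
  "derived_family j M \<delta> =
     {A \<in> PowPset_rel (elts M) (crit j (elts M)) \<delta>. j ` elts \<delta> \<in> elts ` elts (j A)}"

end

theory Submission
  imports Defs "HOL-Library.Countable"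
begin

text \<open>
  Both directions compare a normal ultrafilter \<open>U\<close> on \<open>P\<^sub>\<kappa>(\<mu>)\<close> with the elements of a model that contain
  a single set \<open>a \<in> P\<^sub>\<kappa>(\<mu>)\<close>.

  From supercompactness to small embeddings, no ultrapower is formed. Fix \<open>\<theta>\<close>, let \<open>W\<close> be the
  element of \<open>H(\<theta>)\<close> that codes \<open>U\<close>, and for \<open>a \<in> P\<^sub>\<kappa>(\<mu>)\<close> let \<open>X\<^sub>a\<close> be the Skolem hull of
  \<open>a \<union> {\<kappa>, \<mu>, W}\<close> in \<open>H(\<theta>)\<close>. A property that holds of each individual term for \<open>U\<close>-almost all \<open>a\<close>
  holds for \<open>U\<close>-almost all \<open>a\<close> simultaneously for all terms with parameters in \<open>a\<close>: this is normality,
  iterated over the finitely many parameters of a term, together with countable completeness for the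
  countably many shapes of terms (\<open>almost_all_tms\<close>). Therefore almost every \<open>a\<close> satisfies
  \<open>X\<^sub>a \<inter> \<mu> = a\<close>, has \<open>a \<inter> \<kappa>\<close> as an initial segment of \<open>\<kappa>\<close>, and is generic in the sense that
  \<open>a \<in> z\<close> is equivalent to \<open>z \<inter> P\<^sub>\<kappa>(\<mu>) \<in> U\<close> for all \<open>z \<in> X\<^sub>a\<close>. Fix one such \<open>a\<close>. Let \<open>M\<close> be the
  Mostowski collapse of \<open>X\<^sub>a\<close> and \<open>j : M \<rightarrow> H(\<theta>)\<close> the inverse of the collapse. Its critical point is
  \<open>a \<inter> \<kappa>\<close>, which \<open>j\<close> sends to \<open>\<kappa>\<close>; the ordinal \<open>\<delta>\<close> is the order type of \<open>a\<close>, and \<open>j[\<delta>] = a\<close>. By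
  genericity the derived family consists of the \<open>A \<in> M\<close> with \<open>j(A) \<in> W\<close>, so it is the image of \<open>W\<close>
  under the collapse and belongs to \<open>M\<close> (\<open>ex_small_embedding\<close>).

  Conversely, let \<open>\<theta>\<close> be so large that \<open>H(\<theta>)\<close> includes the fourth iterated power set of \<open>\<mu>\<close>, and let
  \<open>D \<in> M\<close> be the derived family of \<open>j : M \<rightarrow> H(\<theta>)\<close>. It satisfies a theorem of Los: a formula holds in
  \<open>H(\<theta>)\<close> of \<open>j[\<delta>]\<close> and parameters from the range of \<open>j\<close> iff it holds in \<open>M\<close> for the elements of some
  set in \<open>D\<close> (\<open>derived_Los\<close> is the half that matters). It follows that \<open>M\<close> considers \<open>D\<close> to be a
  normal ultrafilter. This is a first-order property, so \<open>H(\<theta>)\<close> considers \<open>j(D)\<close> to be a normal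
  ultrafilter on \<open>P\<^sub>\<kappa>(\<mu>)\<close>, and \<open>H(\<theta>)\<close> contains every set and function needed to conclude that it
  really is one (\<open>supercompact_of_code\<close>).
\<close>

section \<open>Sets and ordinals of the universe\<close>

text \<open>Classes of the universe that are sets, so that \<open>vset\<close> is meaningful for them.\<close>

definition small :: "'v::zfc_universe set \<Rightarrow> bool" where
  "small X \<longleftrightarrow> (\<exists>z. elts z = X)"

lemma small_elts [simp]: "small (elts x)"
  by (auto simp: small_def)

lemma small_subset: "small Y \<Longrightarrow> X \<subseteq> Y \<Longrightarrow> small X"
proof -
  assume "small Y" "X \<subseteq> Y"
  then obtain y where y: "elts y = Y" unfolding small_def by blast
  obtain z where "elts z = {x \<in> elts y. x \<in> X}" using separation[of y "\<lambda>x. x \<in> X"] by blast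
  also have "\<dots> = X" using y \<open>X \<subseteq> Y\<close> by auto
  finally show "small X" unfolding small_def by blast
qed

lemma small_image [simp]: "small X \<Longrightarrow> small (f ` X)" for f :: "'v::zfc_universe \<Rightarrow> 'v"
proof -
  assume "small X"
  then obtain x where "elts x = X" unfolding small_def by blast
  with replacement[of f x] show "small (f ` X)" unfolding small_def by simp
qed

lemma small_lepoll: "X \<lesssim> elts x \<Longrightarrow> small X" for X :: "'v::zfc_universe set" and x :: 'v
  unfolding lepoll_iff by (metis small_elts small_image small_subset)

lemma small_pair [simp]: "small {x, y}"
  using pairing[of x y] by (simp add: small_def)

lemma small_singleton [simp]: "small {x}"
  using small_pair[of x x] by simp

lemma small_Pow [simp]: "small {y. elts y \<subseteq> elts x}"
  using power_set[of x] by (simp add: small_def)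

lemma elts_vset [simp]: "small X \<Longrightarrow> elts (vset X) = X"
proof -
  assume "small X"
  then obtain z where z: "elts z = X" unfolding small_def by blast
  have "elts (THE x. elts x = X) = X"
    by (rule theI[of _ z]) (auto intro: z extensionality simp: z)
  then show ?thesis by (simp add: vset_def)
qed

lemma vset_elts [simp]: "vset (elts x) = x"
  by (rule extensionality) simp

lemma wf_mem: "wf {(x, y::'v::zfc_universe). x \<in> elts y}"
  by (rule foundation)

lemma mem_induct [case_names mem]:
  assumes "\<And>x::'v::zfc_universe. (\<And>y. y \<in> elts x \<Longrightarrow> P y) \<Longrightarrow> P x"
  shows "P x"
  using wf_mem by (rule wf_induct_rule) (use assms in auto)

lemma mem_irrefl: "x \<notin> elts x"
  using wf_not_refl[OF wf_mem, of x] by simp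

lemma mem_asym: "x \<in> elts y \<Longrightarrow> y \<notin> elts x"
  using wf_not_sym[OF wf_mem, of x y] by simp

lemma Ord_mem: "Ord \<alpha> \<Longrightarrow> \<beta> \<in> elts \<alpha> \<Longrightarrow> Ord \<beta>"
  unfolding Ord_def Transset_def by blast

lemma Ord_trans: "Ord \<alpha> \<Longrightarrow> \<beta> \<in> elts \<alpha> \<Longrightarrow> \<gamma> \<in> elts \<beta> \<Longrightarrow> \<gamma> \<in> elts \<alpha>"
  unfolding Ord_def Transset_def by blast

lemma Ord_linear:
  assumes "Ord \<alpha>" "Ord \<beta>"
  shows "\<alpha> \<in> elts \<beta> \<or> \<alpha> = \<beta> \<or> \<beta> \<in> elts \<alpha>"
  using assms
proof (induction \<alpha> arbitrary: \<beta> rule: mem_induct)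
  case (mem \<alpha>)
  note outer = mem
  show ?case using \<open>Ord \<beta>\<close>
  proof (induction \<beta> rule: mem_induct)
    case (mem \<beta>)
    show ?case
    proof (rule ccontr)
      assume n: "\<not> ?case"
      have "x \<in> elts \<beta>" if "x \<in> elts \<alpha>" for x
        using outer(1)[OF that Ord_mem[OF outer(2) that] mem.prems] n that
          Ord_trans[OF outer(2) that] by blast
      moreover have "x \<in> elts \<alpha>" if "x \<in> elts \<beta>" for x
        using mem.IH[OF that Ord_mem[OF mem.prems that]] n that
          Ord_trans[OF mem.prems that] by blast
      ultimately have "\<alpha> = \<beta>" by (intro extensionality) blast
      with n show False by blast
    qed
  qed
qed

lemma Ord_not_mem: "Ord \<alpha> \<Longrightarrow> Ord \<beta> \<Longrightarrow> \<alpha> \<notin> elts \<beta> \<Longrightarrow> elts \<beta> \<subseteq> elts \<alpha>"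
  using Ord_linear Ord_trans by blast

lemma Ord_subset_mem:
  "Ord \<alpha> \<Longrightarrow> Ord \<beta> \<Longrightarrow> elts \<alpha> \<subseteq> elts \<beta> \<Longrightarrow> \<alpha> = \<beta> \<or> \<alpha> \<in> elts \<beta>"
  using Ord_linear mem_irrefl by blast

lemma Ord_subset_mem_trans:
  "Ord \<alpha> \<Longrightarrow> Ord \<theta> \<Longrightarrow> elts \<alpha> \<subseteq> elts \<beta> \<Longrightarrow> \<beta> \<in> elts \<theta> \<Longrightarrow> \<alpha> \<in> elts \<theta>"
  using Ord_subset_mem[of \<alpha> \<beta>] Ord_mem[of \<theta> \<beta>] Ord_trans[of \<theta> \<beta> \<alpha>] by blast

lemma Ord_vset:
  assumes "small X" "\<And>x. x \<in> X \<Longrightarrow> Ord x" "\<And>x y. x \<in> X \<Longrightarrow> y \<in> elts x \<Longrightarrow> y \<in> X"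
  shows "Ord (vset X)"
  using assms unfolding Ord_def Transset_def by auto

lemma Card_Ord: "Card \<kappa> \<Longrightarrow> Ord \<kappa>"
  by (simp add: Card_def)

lemma least_Ord:
  assumes "Ord \<alpha>" "P \<alpha>"
  obtains \<beta> where "Ord \<beta>" "P \<beta>" "\<And>\<gamma>. Ord \<gamma> \<Longrightarrow> P \<gamma> \<Longrightarrow> elts \<beta> \<subseteq> elts \<gamma>"
proof -
  have "\<alpha> \<in> {\<beta>. Ord \<beta> \<and> P \<beta>}" using assms by simp
  from wfE_min[OF wf_mem this] obtain \<beta> where
    "Ord \<beta>" "P \<beta>" and min: "\<And>\<gamma>. \<gamma> \<in> elts \<beta> \<Longrightarrow> \<not> (Ord \<gamma> \<and> P \<gamma>)" by auto
  moreover have "elts \<beta> \<subseteq> elts \<gamma>" if "Ord \<gamma>" "P \<gamma>" for \<gamma>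
    using Ord_not_mem[of \<gamma> \<beta>] that min \<open>Ord \<beta>\<close> by blast
  ultimately show ?thesis using that by blast
qed

section \<open>The Mostowski collapse\<close>

text \<open>For an arbitrary well-founded relation the collapse gives order types of subsets of ordinals and
  of well-orderings, besides the transitive collapse of an elementary substructure. A point with too
  many predecessors gets an arbitrary value.\<close>

definition collapse :: "('v::zfc_universe \<times> 'v) set \<Rightarrow> 'v \<Rightarrow> 'v" where
  "collapse R = wfrec R (\<lambda>f x. vset (f ` {y. (y, x) \<in> R}))"

definition mem_on :: "'v::zfc_universe set \<Rightarrow> ('v \<times> 'v) set" where
  "mem_on A = {(y, x). y \<in> A \<and> x \<in> A \<and> y \<in> elts x}"

lemma wf_mem_on: "wf (mem_on A)"
  by (rule wf_subset[OF wf_mem]) (auto simp: mem_on_def)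

lemma small_mem_on: "small {y. (y, x) \<in> mem_on A}"
  by (rule small_subset[of "elts x"]) (auto simp: mem_on_def)

lemma elts_collapse:
  assumes "wf R" "\<And>x. small {y. (y, x) \<in> R}"
  shows "elts (collapse R x) = collapse R ` {y. (y, x) \<in> R}"
proof -
  have "collapse R x = vset (cut (collapse R) R x ` {y. (y, x) \<in> R})"
    unfolding collapse_def by (subst wfrec[OF assms(1)]) simp
  also have "cut (collapse R) R x ` {y. (y, x) \<in> R} = collapse R ` {y. (y, x) \<in> R}"
    by (auto simp: cut_def)
  finally show ?thesis using assms(2) by simp
qed

lemma inj_on_collapse:
  assumes R: "wf R" "\<And>x. small {y. (y, x) \<in> R}" "R \<subseteq> A \<times> A"
    and ext: "\<And>x y. x \<in> A \<Longrightarrow> y \<in> A \<Longrightarrow> (\<And>z. (z, x) \<in> R \<longleftrightarrow> (z, y) \<in> R) \<Longrightarrow> x = y"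
  shows "inj_on (collapse R) A"
proof -
  have "x = y" if "x \<in> A" "y \<in> A" "collapse R x = collapse R y" for x y
    using R(1) that
  proof (induction x arbitrary: y rule: wf_induct_rule)
    case (less x)
    have eq: "collapse R ` {z. (z, x) \<in> R} = collapse R ` {z. (z, y) \<in> R}"
      using less.prems(3) elts_collapse[OF R(1,2)] by metis
    show ?case
    proof (rule ext)
      fix z
      show "(z, x) \<in> R \<longleftrightarrow> (z, y) \<in> R"
      proof
        assume z: "(z, x) \<in> R"
        then have "collapse R z \<in> collapse R ` {z. (z, y) \<in> R}" using eq by blast
        then obtain w where w: "(w, y) \<in> R" "collapse R z = collapse R w" by blast
        then have "z = w" using less.IH[OF z _ _ w(2)] z R(3) by blast
        with w show "(z, y) \<in> R" by simp
      next
        assume z: "(z, y) \<in> R"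
        then have "collapse R z \<in> collapse R ` {z. (z, x) \<in> R}" using eq by blast
        then obtain w where w: "(w, x) \<in> R" "collapse R z = collapse R w" by blast
        then have "w = z" using less.IH[OF w(1) _ _ w(2)[symmetric]] z R(3) by blast
        with w show "(z, x) \<in> R" by simp
      qed
    qed (use less.prems in auto)
  qed
  then show ?thesis by (auto simp: inj_on_def)
qed

text \<open>For a transitive relation the collapse is the rank function, and its values are transitive sets
  of transitive sets.\<close>

lemma Ord_collapse:
  assumes R: "wf R" "\<And>x. small {y. (y, x) \<in> R}" "trans R"
  shows "Ord (collapse R x)"
  using R(1)
proof (induction x rule: wf_induct_rule)
  case (less x)
  have e: "elts (collapse R z) = collapse R ` {y. (y, z) \<in> R}" for z
    by (rule elts_collapse[OF R(1,2)])
  have "Transset (collapse R x)"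
    unfolding Transset_def e using transD[OF R(3)] e by blast
  moreover have "Transset y" if "y \<in> elts (collapse R x)" for y
    using that less.IH unfolding e by (auto simp: Ord_def)
  ultimately show ?case by (simp add: Ord_def)
qed

lemma Ord_order_type:
  assumes "small A" "wf R" "R \<subseteq> A \<times> A" "trans R"
  shows "Ord (vset (collapse R ` A))"
proof (rule Ord_vset)
  have sm: "small {y. (y, x) \<in> R}" for x
    by (rule small_subset[OF assms(1)]) (use assms(3) in auto)
  show "Ord x" if "x \<in> collapse R ` A" for x
    using that Ord_collapse[OF assms(2) sm assms(4)] by auto
  show "y \<in> collapse R ` A" if "x \<in> collapse R ` A" "y \<in> elts x" for x y
    using that elts_collapse[OF assms(2) sm] assms(3) by blast
qed (use assms in simp)

section \<open>Cardinality\<close>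

text \<open>The order type of a set of ordinals below \<open>\<beta>\<close> is at most \<open>\<beta>\<close>, because the
  collapse never increases an ordinal.\<close>

lemma subset_Ord_eqpoll:
  assumes "Ord \<beta>" "Y \<subseteq> elts \<beta>"
  obtains \<gamma> where "Ord \<gamma>" "elts \<gamma> \<subseteq> elts \<beta>" "Y \<approx> elts \<gamma>"
proof -
  let ?c = "collapse (mem_on Y)"
  have smY: "small Y"
    using assms(2) by (rule small_subset[OF small_elts])
  have O: "Ord y" if "y \<in> Y" for y
    using assms Ord_mem that by blast
  have elts_c: "elts (?c x) = ?c ` {y. (y, x) \<in> mem_on Y}" for x
    by (rule elts_collapse[OF wf_mem_on small_mem_on])
  have tr: "trans (mem_on Y)"
    by (rule transI) (use Ord_trans O in \<open>auto simp: mem_on_def\<close>)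
  have inj: "inj_on ?c Y"
  proof (rule inj_on_collapse[OF wf_mem_on small_mem_on])
    show "mem_on Y \<subseteq> Y \<times> Y" by (auto simp: mem_on_def)
    fix x y assume "x \<in> Y" "y \<in> Y" and eq: "\<And>z. (z, x) \<in> mem_on Y \<longleftrightarrow> (z, y) \<in> mem_on Y"
    then have "x \<notin> elts y" "y \<notin> elts x"
      using eq[of x] eq[of y] mem_irrefl by (auto simp: mem_on_def)
    then show "x = y" using Ord_linear O \<open>x \<in> Y\<close> \<open>y \<in> Y\<close> by blast
  qed
  have Oc: "Ord (?c x)" for x
    by (rule Ord_collapse[OF wf_mem_on small_mem_on tr])
  have le: "elts (?c x) \<subseteq> elts x" if "x \<in> Y" for x
    using that
  proof (induction x rule: mem_induct)
    case (mem x)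
    show ?case
    proof
      fix z assume "z \<in> elts (?c x)"
      then obtain y where y: "y \<in> Y" "y \<in> elts x" "z = ?c y"
        unfolding elts_c by (auto simp: mem_on_def)
      show "z \<in> elts x"
        using Ord_subset_mem_trans[OF Oc O[OF mem.prems] mem.IH[OF y(2,1)] y(2)] y(3) by simp
    qed
  qed
  let ?g = "vset (?c ` Y)"
  have eg: "elts ?g = ?c ` Y"
    using smY by simp
  have "Ord ?g"
    by (rule Ord_order_type[OF smY wf_mem_on _ tr]) (auto simp: mem_on_def)
  moreover have "elts ?g \<subseteq> elts \<beta>"
    using Ord_subset_mem_trans[OF Oc assms(1) le] assms(2) by (auto simp: eg)
  moreover have "Y \<approx> elts ?g"
    using inj_on_image_eqpoll_self[OF inj] eg eqpoll_sym by metis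
  ultimately show ?thesis using that by blast
qed

text \<open>An injection into an ordinal below \<open>\<theta>\<close> suffices, because its range has an order type.\<close>

lemma card_less_lepoll:
  assumes "Ord \<theta>" "\<beta> \<in> elts \<theta>" "X \<lesssim> elts \<beta>"
  shows "card_less X \<theta>"
proof -
  obtain f where f: "inj_on f X" "f ` X \<subseteq> elts \<beta>"
    using assms(3) unfolding lepoll_def by blast
  obtain \<gamma> where \<gamma>: "Ord \<gamma>" "elts \<gamma> \<subseteq> elts \<beta>" "f ` X \<approx> elts \<gamma>"
    using subset_Ord_eqpoll[OF Ord_mem[OF assms(1,2)] f(2)] .
  have "X \<approx> elts \<gamma>"
    using \<gamma>(3) f(1) by simp
  then show ?thesis
    using Ord_subset_mem_trans[OF \<gamma>(1) assms(1) \<gamma>(2) assms(2)] unfolding card_less_def by blast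
qed

lemma card_less_mono:
  assumes "Ord \<theta>" "card_less Y \<theta>" "X \<lesssim> Y"
  shows "card_less X \<theta>"
  using assms card_less_lepoll lepoll_trans eqpoll_imp_lepoll unfolding card_less_def by blast

lemma Card_not_lepoll_mem:
  assumes "Card \<kappa>" "\<beta> \<in> elts \<kappa>"
  shows "\<not> elts \<kappa> \<lesssim> elts \<beta>"
proof
  assume "elts \<kappa> \<lesssim> elts \<beta>"
  moreover have "elts \<beta> \<lesssim> elts \<kappa>"
    using Ord_trans[OF Card_Ord[OF assms(1)] assms(2)] by (auto intro: subset_imp_lepoll)
  ultimately show False
    using assms lepoll_antisym eqpoll_sym unfolding Card_def by blast
qed

text \<open>The ordinal is the order type of a well-ordering of the set.\<close>

lemma lepoll_Ord:
  fixes x :: "'v::zfc_universe"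
  obtains \<beta> :: 'v where "Ord \<beta>" "elts x \<lesssim> elts \<beta>"
proof -
  obtain r where "well_order_on (elts x) r"
    using well_order_on by blast
  then have wf: "wf (r - Id)" and "linear_order_on (elts x) r"
    by (auto simp: well_order_on_def)
  then have total: "total_on (elts x) r" and "trans r" "antisym r" and fld: "r \<subseteq> elts x \<times> elts x"
    by (auto simp: linear_order_on_def partial_order_on_def preorder_on_def refl_on_def)
  let ?R = "r - Id"
  have tr: "trans ?R"
    using \<open>trans r\<close> \<open>antisym r\<close> by (rule trans_diff_Id)
  have sm: "small {y. (y, z) \<in> ?R}" for z
    by (rule small_subset[OF small_elts[of x]]) (use fld in auto)
  have sub: "?R \<subseteq> elts x \<times> elts x" using fld by blast
  have inj: "inj_on (collapse ?R) (elts x)"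
  proof (rule inj_on_collapse[OF wf sm sub])
    fix y z assume yz: "y \<in> elts x" "z \<in> elts x"
      and eq: "\<And>w. (w, y) \<in> ?R \<longleftrightarrow> (w, z) \<in> ?R"
    show "y = z"
      using eq[of y] eq[of z] total yz unfolding total_on_def by blast
  qed
  have "Ord (vset (collapse ?R ` elts x))"
    by (rule Ord_order_type[OF small_elts wf sub tr])
  moreover have "elts x \<lesssim> elts (vset (collapse ?R ` elts x))"
    using inj by (auto simp: lepoll_def)
  ultimately show ?thesis using that by blast
qed

lemma Ord_above:
  fixes x \<alpha> :: "'v::zfc_universe"
  assumes "Ord \<alpha>"
  obtains \<beta> :: 'v where "Ord \<beta>" "elts x \<lesssim> elts \<beta>" "elts \<alpha> \<subseteq> elts \<beta>"
proof -
  obtain \<beta> :: 'v where \<beta>: "Ord \<beta>" "elts x \<lesssim> elts \<beta>" by (rule lepoll_Ord)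
  show ?thesis
  proof (cases "elts \<alpha> \<subseteq> elts \<beta>")
    case False
    then have "elts \<beta> \<subseteq> elts \<alpha>"
      using Ord_linear[OF assms \<beta>(1)] Ord_trans assms \<beta>(1) by blast
    then show ?thesis
      using that[of \<alpha>] assms \<beta> subset_imp_lepoll lepoll_trans by blast
  qed (use that \<beta> in blast)
qed

text \<open>Cardinals are unbounded: the least ordinal that the power set of \<open>\<beta>\<close> injects into is a
  cardinal above \<open>\<beta>\<close>.\<close>

lemma Card_above:
  fixes \<beta> :: "'v::zfc_universe"
  assumes "Ord \<beta>"
  obtains \<theta> where "Card \<theta>" "\<beta> \<in> elts \<theta>"
proof -
  let ?P = "{y. elts y \<subseteq> elts \<beta>}"
  have Pow: "Pow (elts \<beta>) \<lesssim> ?P"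
  proof -
    have elts: "elts (vset Z) = Z" if "Z \<in> Pow (elts \<beta>)" for Z
      using small_subset[OF small_elts, of Z \<beta>] that by simp
    have "inj_on vset (Pow (elts \<beta>))"
      using elts by (metis inj_onI)
    moreover have "vset ` Pow (elts \<beta>) \<subseteq> ?P"
      using elts by blast
    ultimately show ?thesis unfolding lepoll_def by blast
  qed
  obtain \<gamma> :: 'v where "Ord \<gamma>" "elts (vset ?P) \<lesssim> elts \<gamma>" by (rule lepoll_Ord)
  then have "?P \<lesssim> elts \<gamma>" by simp
  with \<open>Ord \<gamma>\<close> obtain \<theta> :: 'v where \<theta>: "Ord \<theta>" "?P \<lesssim> elts \<theta>"
    and least: "\<And>\<gamma>. Ord \<gamma> \<Longrightarrow> ?P \<lesssim> elts \<gamma> \<Longrightarrow> elts \<theta> \<subseteq> elts \<gamma>"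
    by (rule least_Ord[where P = "\<lambda>\<gamma>. ?P \<lesssim> elts \<gamma>"]) blast
  have "Card \<theta>"
    unfolding Card_def
  proof (intro conjI ballI notI)
    fix \<eta> assume "\<eta> \<in> elts \<theta>" "elts \<eta> \<approx> elts \<theta>"
    then have "?P \<lesssim> elts \<eta>"
      using \<theta>(2) eqpoll_sym lepoll_trans2 by blast
    then have "elts \<theta> \<subseteq> elts \<eta>"
      using least Ord_mem \<theta>(1) \<open>\<eta> \<in> elts \<theta>\<close> by blast
    with \<open>\<eta> \<in> elts \<theta>\<close> show False using mem_irrefl by blast
  qed (rule \<theta>(1))
  moreover have "\<beta> \<in> elts \<theta>"
  proof (rule ccontr)
    assume "\<beta> \<notin> elts \<theta>"
    then have "elts \<theta> \<subseteq> elts \<beta>" using Ord_not_mem assms \<theta>(1) by blast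
    then have "Pow (elts \<beta>) \<lesssim> elts \<beta>"
      using Pow \<theta>(2) by (meson lepoll_trans subset_imp_lepoll)
    then show False
      using lesspoll_Pow_self lesspoll_trans2 lesspoll_not_refl by blast
  qed
  ultimately show ?thesis using that by blast
qed

lemma Card_infinite_mem:
  assumes "Card \<kappa>" "uncountable (elts \<kappa>)"
  obtains \<beta> where "\<beta> \<in> elts \<kappa>" "infinite (elts \<beta>)"
proof (rule ccontr)
  assume "\<not> thesis"
  with that have fin: "\<And>\<beta>. \<beta> \<in> elts \<kappa> \<Longrightarrow> finite (elts \<beta>)" by blast
  have O: "Ord \<beta>" if "\<beta> \<in> elts \<kappa>" for \<beta>
    using Ord_mem Card_Ord assms that by blast
  have less: "card (elts \<beta>) < card (elts \<gamma>)"
    if "\<beta> \<in> elts \<gamma>" "\<gamma> \<in> elts \<kappa>" for \<beta> \<gamma>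
  proof (rule psubset_card_mono)
    show "elts \<beta> \<subset> elts \<gamma>"
      using Ord_trans[OF O[OF that(2)] that(1)] that(1) mem_irrefl by blast
  qed (use fin that in blast)
  have "inj_on (\<lambda>\<beta>. card (elts \<beta>)) (elts \<kappa>)"
    by (rule inj_onI) (metis O Ord_linear less less_irrefl_nat)
  then have "countable (elts \<kappa>)" by (rule countableI)
  with assms(2) show False by simp
qed

text \<open>This turns completeness for families of size less than \<open>\<kappa>\<close> into countable completeness: an
  uncountable cardinal has an infinite element, since finite ordinals are determined by their
  number of elements.\<close>

lemma card_less_countable:
  assumes "Card \<kappa>" "uncountable (elts \<kappa>)" "countable X"
  shows "card_less X \<kappa>"
proof -
  obtain \<beta> where \<beta>: "\<beta> \<in> elts \<kappa>" "infinite (elts \<beta>)"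
    using Card_infinite_mem[OF assms(1,2)] .
  have "X \<lesssim> (UNIV :: nat set)"
    using assms(3) unfolding countable_def lepoll_def by blast
  also have "(UNIV :: nat set) \<lesssim> elts \<beta>"
    using \<beta>(2) infinite_le_lepoll by blast
  finally show ?thesis
    using card_less_lepoll[OF Card_Ord[OF assms(1)] \<beta>(1)] by blast
qed

section \<open>Hereditary cardinality\<close>

lemma trcl_mono: "y \<in> elts x \<Longrightarrow> trcl y \<subseteq> trcl x"
  unfolding trcl_def by (auto intro: trancl.trancl_into_trancl)

lemma trcl_subset:
  assumes "Transset x" "elts y \<subseteq> elts x"
  shows "trcl y \<subseteq> elts x"
proof -
  have "u \<in> elts x" if "(u, y) \<in> {(u, v). u \<in> elts v}\<^sup>+" for u
    using that
    by (induction rule: converse_trancl_induct) (use assms in \<open>auto simp: Transset_def\<close>)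
  then show ?thesis by (auto simp: trcl_def)
qed

lemma Hset_mem:
  assumes "Ord \<theta>" "x \<in> Hset \<theta>" "y \<in> elts x"
  shows "y \<in> Hset \<theta>"
  using card_less_mono[OF assms(1)] assms(2) subset_imp_lepoll[OF trcl_mono[OF assms(3)]]
  by (auto simp: Hset_def)

lemma Hset_subset:
  assumes "Ord \<theta>" "x \<in> Hset \<theta>" "elts y \<subseteq> elts x"
  shows "y \<in> Hset \<theta>"
proof -
  have "trcl y \<subseteq> trcl x"
    unfolding trcl_def
  proof (intro subsetI CollectI)
    fix u assume "u \<in> {u. (u, y) \<in> {(u, v). u \<in> elts v}\<^sup>+}"
    then have "(u, y) \<in> {(u, v). u \<in> elts v}\<^sup>+" by simp
    then show "(u, x) \<in> {(u, v). u \<in> elts v}\<^sup>+"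
      by (cases rule: trancl.cases) (use assms(3) in \<open>auto intro: trancl.intros\<close>)
  qed
  then show ?thesis
    using card_less_mono[OF assms(1)] assms(2) subset_imp_lepoll unfolding Hset_def by blast
qed

definition VPow :: "'v::zfc_universe \<Rightarrow> 'v" where
  "VPow x = vset {y. elts y \<subseteq> elts x}"

lemma elts_VPow [simp]: "elts (VPow x) = {y. elts y \<subseteq> elts x}"
  by (simp add: VPow_def)

lemma Transset_VPow: "Transset x \<Longrightarrow> Transset (VPow x)"
  by (auto simp: Transset_def)

lemma VPow_increasing: "Transset x \<Longrightarrow> y \<in> elts x \<Longrightarrow> y \<in> elts (VPow x)"
  by (auto simp: Transset_def)

text \<open>Everything needed from "sufficiently large" cardinals \<open>\<theta>\<close>: a transitive set injecting into an
  ordinal below \<open>\<theta>\<close> is a subset of \<open>H(\<theta>)\<close>.\<close>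

lemma elts_subset_Hset:
  assumes "Transset B" "Ord \<theta>" "\<beta> \<in> elts \<theta>" "elts B \<lesssim> elts \<beta>" "x \<in> elts B"
  shows "x \<in> Hset \<theta>"
proof -
  have "trcl x \<subseteq> elts B"
    using trcl_subset[OF assms(1)] assms(1,5) by (auto simp: Transset_def)
  then have "trcl x \<lesssim> elts \<beta>"
    using assms(4) lepoll_trans subset_imp_lepoll by blast
  then show ?thesis
    using card_less_lepoll assms(2,3) by (auto simp: Hset_def)
qed

section \<open>Formulas\<close>

primrec fv :: "fm \<Rightarrow> nat set" where
  "fv (Member m n) = {m, n}"
| "fv (Equal m n) = {m, n}"
| "fv (Neg \<phi>) = fv \<phi>"
| "fv (Conj \<phi> \<psi>) = fv \<phi> \<union> fv \<psi>"
| "fv (Forall n \<phi>) = fv \<phi> - {n}"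

lemma finite_fv: "finite (fv \<phi>)"
  by (induction \<phi>) auto

lemma satisfies_cong:
  "(\<And>i. i \<in> fv \<phi> \<Longrightarrow> s i = s' i) \<Longrightarrow> satisfies N \<phi> s \<longleftrightarrow> satisfies N \<phi> s'"
proof (induction \<phi> arbitrary: s s')
  case (Neg \<phi>)
  from Neg.IH[of s s'] Neg.prems show ?case by simp
next
  case (Conj \<phi> \<psi>)
  from Conj.IH(1)[of s s'] Conj.IH(2)[of s s'] Conj.prems show ?case by simp
next
  case (Forall n \<phi>)
  have "satisfies N \<phi> (s(n := x)) \<longleftrightarrow> satisfies N \<phi> (s'(n := x))" for x
    by (rule Forall.IH) (use Forall.prems in auto)
  then show ?case by simp
qed auto

text \<open>Variables are named, so capture has to be avoided by hand: each of the formula schemes for pairs,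
  bijections and small subsets binds only indices above a bound, and its satisfaction lemma requires
  the indices of the arguments to be below that bound.\<close>

definition FOr :: "fm \<Rightarrow> fm \<Rightarrow> fm" where "FOr \<phi> \<psi> = Neg (Conj (Neg \<phi>) (Neg \<psi>))"
definition FImp :: "fm \<Rightarrow> fm \<Rightarrow> fm" where "FImp \<phi> \<psi> = Neg (Conj \<phi> (Neg \<psi>))"
definition FIff :: "fm \<Rightarrow> fm \<Rightarrow> fm" where "FIff \<phi> \<psi> = Conj (FImp \<phi> \<psi>) (FImp \<psi> \<phi>)"
definition FEx :: "nat \<Rightarrow> fm \<Rightarrow> fm" where "FEx n \<phi> = Neg (Forall n (Neg \<phi>))"
definition FAllIn :: "nat \<Rightarrow> nat \<Rightarrow> fm \<Rightarrow> fm" where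
  "FAllIn n m \<phi> = Forall n (FImp (Member n m) \<phi>)"
definition FExIn :: "nat \<Rightarrow> nat \<Rightarrow> fm \<Rightarrow> fm" where
  "FExIn n m \<phi> = FEx n (Conj (Member n m) \<phi>)"

lemma fv_connectives [simp]:
  "fv (FOr \<phi> \<psi>) = fv \<phi> \<union> fv \<psi>"
  "fv (FImp \<phi> \<psi>) = fv \<phi> \<union> fv \<psi>"
  "fv (FIff \<phi> \<psi>) = fv \<phi> \<union> fv \<psi>"
  "fv (FEx n \<phi>) = fv \<phi> - {n}"
  "fv (FAllIn n m \<phi>) = insert m (fv \<phi>) - {n}"
  "fv (FExIn n m \<phi>) = insert m (fv \<phi>) - {n}"
  by (auto simp: FOr_def FImp_def FIff_def FEx_def FAllIn_def FExIn_def)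

lemma satisfies_connectives [simp]:
  "satisfies N (FOr \<phi> \<psi>) s \<longleftrightarrow> satisfies N \<phi> s \<or> satisfies N \<psi> s"
  "satisfies N (FImp \<phi> \<psi>) s \<longleftrightarrow> (satisfies N \<phi> s \<longrightarrow> satisfies N \<psi> s)"
  "satisfies N (FIff \<phi> \<psi>) s \<longleftrightarrow> (satisfies N \<phi> s \<longleftrightarrow> satisfies N \<psi> s)"
  "satisfies N (FEx n \<phi>) s \<longleftrightarrow> (\<exists>x\<in>N. satisfies N \<phi> (s(n := x)))"
  by (auto simp: FOr_def FImp_def FIff_def FEx_def)

definition transitive :: "'v::zfc_universe set \<Rightarrow> bool" where
  "transitive N \<longleftrightarrow> (\<forall>x\<in>N. elts x \<subseteq> N)"

lemma transitiveD: "transitive N \<Longrightarrow> x \<in> N \<Longrightarrow> y \<in> elts x \<Longrightarrow> y \<in> N"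
  by (auto simp: transitive_def)

lemma satisfies_bounded [simp]:
  assumes "transitive N" "s m \<in> N" "n \<noteq> m"
  shows "satisfies N (FAllIn n m \<phi>) s \<longleftrightarrow> (\<forall>x\<in>elts (s m). satisfies N \<phi> (s(n := x)))"
    and "satisfies N (FExIn n m \<phi>) s \<longleftrightarrow> (\<exists>x\<in>elts (s m). satisfies N \<phi> (s(n := x)))"
  using assms transitiveD[OF assms(1,2)] by (auto simp: FAllIn_def FExIn_def)

section \<open>Absoluteness of pairs and bijections\<close>

lemma elts_kpair [simp]: "elts (kpair x y) = {vset {x}, vset {x, y}}"
  by (simp add: kpair_def)

lemma kpair_eq_iff:
  "p = kpair x y \<longleftrightarrow> (\<exists>q\<in>elts p. \<exists>r\<in>elts p. elts p = {q, r} \<and> elts q = {x} \<and> elts r = {x, y})"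
proof
  assume "p = kpair x y"
  then show "\<exists>q\<in>elts p. \<exists>r\<in>elts p. elts p = {q, r} \<and> elts q = {x} \<and> elts r = {x, y}"
    by (intro bexI[of _ "vset {x}"] bexI[of _ "vset {x, y}"]) auto
next
  assume "\<exists>q\<in>elts p. \<exists>r\<in>elts p. elts p = {q, r} \<and> elts q = {x} \<and> elts r = {x, y}"
  then obtain q r where *: "elts p = {q, r}" "elts q = {x}" "elts r = {x, y}" by blast
  then have "q = vset {x}" "r = vset {x, y}" by (metis vset_elts)+
  with * show "p = kpair x y" by (intro extensionality) simp
qed

lemma kpair_inject [simp]: "kpair x y = kpair u v \<longleftrightarrow> x = u \<and> y = v"
proof
  assume eq: "kpair x y = kpair u v"
  then have "\<Inter>(elts ` elts (kpair x y)) = \<Inter>(elts ` elts (kpair u v))"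
    and "\<Union>(elts ` elts (kpair x y)) = \<Union>(elts ` elts (kpair u v))" by simp_all
  then have "{x} = {u}" "{x, y} = {u, v}" by auto
  then show "x = u \<and> y = v" by (auto simp: doubleton_eq_iff)
qed simp

text \<open>The variables 20 and 21 stand for the singleton and the doubleton that make up the Kuratowski pair.\<close>

definition pair_fm :: "nat \<Rightarrow> nat \<Rightarrow> nat \<Rightarrow> fm" where
  "pair_fm p u v = FExIn 20 p (FExIn 21 p (
     Conj (FAllIn 22 p (FOr (Equal 22 20) (Equal 22 21)))
    (Conj (Conj (Member u 20) (FAllIn 22 20 (Equal 22 u)))
          (Conj (Member u 21) (Conj (Member v 21) (FAllIn 22 21 (FOr (Equal 22 u) (Equal 22 v))))))))"

definition in_pair_fm :: "nat \<Rightarrow> nat \<Rightarrow> nat \<Rightarrow> fm" where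
  "in_pair_fm f u v = FExIn 19 f (pair_fm 19 u v)"

definition bij_fm :: "nat \<Rightarrow> nat \<Rightarrow> nat \<Rightarrow> fm" where
  "bij_fm f x y =
     Conj (FAllIn 15 f (FExIn 16 x (FExIn 17 y (pair_fm 15 16 17))))
    (Conj (FAllIn 16 x (FExIn 17 y (in_pair_fm f 16 17)))
    (Conj (FAllIn 17 y (FExIn 16 x (in_pair_fm f 16 17)))
          (FAllIn 15 x (FAllIn 16 y (FAllIn 17 x (FAllIn 18 y
             (FImp (Conj (in_pair_fm f 15 16) (in_pair_fm f 17 18))
                   (FIff (Equal 15 17) (Equal 16 18)))))))))"

text \<open>All quantifiers are bounded except the one over the bijection, which ranges over the
  whole class, in agreement with the relativization \<open>Pset_rel\<close>.\<close>

definition Pset_fm :: "nat \<Rightarrow> nat \<Rightarrow> nat \<Rightarrow> fm" where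
  "Pset_fm a n d = Conj (FAllIn 12 a (Member 12 d)) (FExIn 10 n (FEx 11 (bij_fm 11 a 10)))"

lemma satisfies_pair_fm [simp]:
  assumes "transitive N" "s p \<in> N" "p < 20" "u < 20" "v < 20"
  shows "satisfies N (pair_fm p u v) s \<longleftrightarrow> s p = kpair (s u) (s v)"
proof -
  have "satisfies N (pair_fm p u v) s \<longleftrightarrow>
    (\<exists>q\<in>elts (s p). \<exists>r\<in>elts (s p). (\<forall>z\<in>elts (s p). z = q \<or> z = r) \<and>
      (s u \<in> elts q \<and> (\<forall>z\<in>elts q. z = s u)) \<and>
      s u \<in> elts r \<and> s v \<in> elts r \<and> (\<forall>z\<in>elts r. z = s u \<or> z = s v))"
    using assms transitiveD[OF assms(1,2)] unfolding pair_fm_def by (simp cong: bex_cong_simp)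
  also have "\<dots> \<longleftrightarrow> s p = kpair (s u) (s v)"
    unfolding kpair_eq_iff by (intro bex_cong refl) blast
  finally show ?thesis .
qed

lemma satisfies_in_pair_fm [simp]:
  assumes "transitive N" "s f \<in> N" "f < 19" "u < 19" "v < 19"
  shows "satisfies N (in_pair_fm f u v) s \<longleftrightarrow> kpair (s u) (s v) \<in> elts (s f)"
  using assms transitiveD[OF assms(1,2)] unfolding in_pair_fm_def by (auto cong: bex_cong_simp)

text \<open>A description of bijections by bounded quantifiers, which is what makes them absolute for
  transitive classes.\<close>

lemma bijection_set_iff:
  "bijection_set f x y \<longleftrightarrow>
     (\<forall>p\<in>elts f. \<exists>u\<in>elts x. \<exists>v\<in>elts y. p = kpair u v) \<and>
     (\<forall>u\<in>elts x. \<exists>v\<in>elts y. kpair u v \<in> elts f) \<and>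
     (\<forall>v\<in>elts y. \<exists>u\<in>elts x. kpair u v \<in> elts f) \<and>
     (\<forall>u\<in>elts x. \<forall>v\<in>elts y. \<forall>u'\<in>elts x. \<forall>v'\<in>elts y.
        kpair u v \<in> elts f \<and> kpair u' v' \<in> elts f \<longrightarrow> (u = u' \<longleftrightarrow> v = v'))" (is "_ \<longleftrightarrow> ?R")
proof
  assume "bijection_set f x y"
  then obtain g where g: "bij_betw g (elts x) (elts y)" "elts f = (\<lambda>u. kpair u (g u)) ` elts x"
    by (auto simp: bijection_set_def)
  have mem: "kpair u v \<in> elts f \<longleftrightarrow> u \<in> elts x \<and> v = g u" for u v
    by (auto simp: g(2))
  have "g ` elts x = elts y" "inj_on g (elts x)"
    using g(1) by (auto simp: bij_betw_def)
  then show ?R unfolding mem by (auto simp: g(2) inj_on_def)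
next
  assume R: ?R
  define g where "g u = (SOME v. v \<in> elts y \<and> kpair u v \<in> elts f)" for u
  have g: "g u \<in> elts y" "kpair u (g u) \<in> elts f" if "u \<in> elts x" for u
    using someI_ex[of "\<lambda>v. v \<in> elts y \<and> kpair u v \<in> elts f"] R that unfolding g_def by blast+
  have uniq: "v = g u" if "kpair u v \<in> elts f" "u \<in> elts x" "v \<in> elts y" for u v
    using R that g by blast
  have "inj_on g (elts x)"
    using R g by (intro inj_onI) blast
  moreover have "g ` elts x = elts y"
    using R g(1) uniq by blast
  moreover have "elts f = (\<lambda>u. kpair u (g u)) ` elts x"
  proof (intro equalityI subsetI)
    fix p assume "p \<in> elts f"
    then obtain u v where "u \<in> elts x" "v \<in> elts y" "p = kpair u v" using R by blast
    with uniq \<open>p \<in> elts f\<close> show "p \<in> (\<lambda>u. kpair u (g u)) ` elts x" by blast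
  qed (use g(2) in blast)
  ultimately show "bijection_set f x y"
    unfolding bijection_set_def bij_betw_def by blast
qed

lemma satisfies_bij_fm [simp]:
  assumes "transitive N" "s f \<in> N" "s x \<in> N" "s y \<in> N" "f < 15" "x < 15" "y < 15"
  shows "satisfies N (bij_fm f x y) s \<longleftrightarrow> bijection_set (s f) (s x) (s y)"
  using assms transitiveD[OF assms(1,2)] transitiveD[OF assms(1,3)] transitiveD[OF assms(1,4)]
  unfolding bij_fm_def bijection_set_iff by (simp cong: bex_cong_simp ball_cong_simp)

lemma satisfies_Pset_fm [simp]:
  assumes "transitive N" "s a \<in> N" "s n \<in> N" "a < 10" "n < 10" "d < 10"
  shows "satisfies N (Pset_fm a n d) s \<longleftrightarrow> s a \<in> Pset_rel N (s n) (s d)"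
  using assms transitiveD[OF assms(1,3)]
  unfolding Pset_fm_def Pset_rel_def by (auto cong: bex_cong_simp ball_cong_simp)

section \<open>Elementary embeddings of transitive classes\<close>

text \<open>Closure of \<open>H\<close> under subsets holds for \<open>H(\<theta>)\<close> and provides separation in \<open>H\<close>.\<close>

locale transitive_embedding =
  fixes j :: "'v::zfc_universe \<Rightarrow> 'v" and M H :: "'v set"
  assumes transitive_M: "transitive M" and transitive_H: "transitive H"
    and elementary: "elementary_embedding j M H"
    and H_subset: "x \<in> H \<Longrightarrow> elts y \<subseteq> elts x \<Longrightarrow> y \<in> H"
begin

lemma j_in_H [simp]: "x \<in> M \<Longrightarrow> j x \<in> H"
  using elementary by (auto simp: elementary_embedding_def)

text \<open>The parameters of a formula sit at the variables \<open>0\<close>, \<open>2\<close>, \<open>3\<close> and \<open>4\<close>.\<close>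

lemma transfer:
  assumes "a \<in> M" "b \<in> M" "c \<in> M" "d \<in> M"
  shows "satisfies M \<phi> ((\<lambda>_. a)(2 := b, 3 := c, 4 := d)) \<longleftrightarrow>
         satisfies H \<phi> ((\<lambda>_. j a)(2 := j b, 3 := j c, 4 := j d))"
proof -
  let ?s = "(\<lambda>_. a)(2 := b, 3 := c, 4 := d)"
  have "range ?s \<subseteq> M" using assms by auto
  then have "satisfies M \<phi> ?s \<longleftrightarrow> satisfies H \<phi> (j \<circ> ?s)"
    using elementary unfolding elementary_embedding_def by blast
  also have "j \<circ> ?s = (\<lambda>_. j a)(2 := j b, 3 := j c, 4 := j d)" by (auto simp: fun_eq_iff)
  finally show ?thesis .
qed

lemma j_mem_iff: "x \<in> M \<Longrightarrow> y \<in> M \<Longrightarrow> j x \<in> elts (j y) \<longleftrightarrow> x \<in> elts y"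
  using transfer[of x y x x "Member 0 2"] by simp

lemma j_eq_iff: "x \<in> M \<Longrightarrow> y \<in> M \<Longrightarrow> j x = j y \<longleftrightarrow> x = y"
  using transfer[of x y x x "Equal 0 2"] by simp

lemma j_subset_iff: "x \<in> M \<Longrightarrow> y \<in> M \<Longrightarrow> elts (j x) \<subseteq> elts (j y) \<longleftrightarrow> elts x \<subseteq> elts y"
  using transfer[of x y x x "FAllIn 5 0 (Member 5 2)"] transitive_M transitive_H
  by (auto cong: ball_cong_simp)

lemma j_PowPset_rel_iff:
  assumes "A \<in> M" "c \<in> M" "d \<in> M"
  shows "j A \<in> PowPset_rel H (j c) (j d) \<longleftrightarrow> A \<in> PowPset_rel M c d"
  using transfer[of A c d A "FAllIn 5 0 (Pset_fm 5 2 3)"] assms transitive_M transitive_H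
    transitiveD[OF transitive_M assms(1)] transitiveD[OF transitive_H j_in_H[OF assms(1)]]
  by (auto simp: PowPset_rel_def cong: ball_cong_simp)

text \<open>Separation holds in \<open>M\<close> and commutes with \<open>j\<close>: \<open>H\<close> contains the subsets of its elements,
  hence satisfies every instance of separation, and \<open>M\<close> inherits each one.\<close>

lemma separation_transfer:
  assumes "b \<in> M" "p \<in> M" "q \<in> M" and fv: "fv \<phi> \<subseteq> {0, 2, 3}"
  obtains Y where "Y \<in> M"
    "elts Y = {a \<in> elts b. satisfies M \<phi> ((\<lambda>_. a)(2 := p, 3 := q))}"
    "elts (j Y) = {a \<in> elts (j b). satisfies H \<phi> ((\<lambda>_. a)(2 := j p, 3 := j q))}"
proof -
  have cong: "satisfies N \<phi> (s(0 := a)) \<longleftrightarrow> satisfies N \<phi> ((\<lambda>_. a)(2 := s 2, 3 := s 3))" for N a s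
    by (rule satisfies_cong) (use fv in auto)
  \<comment> \<open>The formula says that the set at 5 is the subset of the set at 4 defined by \<open>\<phi>\<close>. Variable 5 is
    outside the three reassigned indices, so it takes the default value of the assignment.\<close>
  let ?\<chi> = "Forall 0 (FIff (Member 0 5) (Conj (Member 0 4) \<phi>))"
  have sat: "satisfies N ?\<chi> ((\<lambda>_. y)(2 := p', 3 := q', 4 := b')) \<longleftrightarrow>
    (\<forall>a\<in>N. a \<in> elts y \<longleftrightarrow> a \<in> elts b' \<and> satisfies N \<phi> ((\<lambda>_. a)(2 := p', 3 := q')))"
    for N y p' q' b' by (simp add: cong)
  let ?z = "vset {a \<in> elts (j b). satisfies H \<phi> ((\<lambda>_. a)(2 := j p, 3 := j q))}"
  have z: "elts ?z = {a \<in> elts (j b). satisfies H \<phi> ((\<lambda>_. a)(2 := j p, 3 := j q))}"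
    by (rule elts_vset, rule small_subset[OF small_elts[of "j b"]]) auto
  then have "?z \<in> H" using H_subset[of "j b" ?z] assms by auto
  have sat5: "satisfies N (FEx 5 ?\<chi>) ((\<lambda>_. b')(2 := p', 3 := q', 4 := b')) \<longleftrightarrow>
    (\<exists>y\<in>N. \<forall>a\<in>N. a \<in> elts y \<longleftrightarrow> a \<in> elts b' \<and> satisfies N \<phi> ((\<lambda>_. a)(2 := p', 3 := q')))"
    for N p' q' b' by (simp add: cong)
  have "satisfies H (FEx 5 ?\<chi>) ((\<lambda>_. j b)(2 := j p, 3 := j q, 4 := j b))"
    unfolding sat5 using \<open>?z \<in> H\<close> z by blast
  then have "satisfies M (FEx 5 ?\<chi>) ((\<lambda>_. b)(2 := p, 3 := q, 4 := b))"
    using transfer assms(1-3) by blast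
  then obtain Y where Y: "Y \<in> M"
    and mem: "\<And>a. a \<in> M \<Longrightarrow> a \<in> elts Y \<longleftrightarrow> a \<in> elts b \<and> satisfies M \<phi> ((\<lambda>_. a)(2 := p, 3 := q))"
    unfolding sat5 by blast
  have "satisfies M ?\<chi> ((\<lambda>_. Y)(2 := p, 3 := q, 4 := b))"
    unfolding sat using mem by blast
  then have "satisfies H ?\<chi> ((\<lambda>_. j Y)(2 := j p, 3 := j q, 4 := j b))"
    using transfer assms(1-3) Y by blast
  then have memj: "\<And>a. a \<in> H \<Longrightarrow> a \<in> elts (j Y) \<longleftrightarrow>
      a \<in> elts (j b) \<and> satisfies H \<phi> ((\<lambda>_. a)(2 := j p, 3 := j q))"
    unfolding sat by blast
  show ?thesis
  proof (rule that[OF Y])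
    show "elts Y = {a \<in> elts b. satisfies M \<phi> ((\<lambda>_. a)(2 := p, 3 := q))}"
      using mem transitiveD[OF transitive_M Y] transitiveD[OF transitive_M assms(1)] by blast
    show "elts (j Y) = {a \<in> elts (j b). satisfies H \<phi> ((\<lambda>_. a)(2 := j p, 3 := j q))}"
      using memj transitiveD[OF transitive_H j_in_H[OF Y]]
        transitiveD[OF transitive_H j_in_H[OF assms(1)]] by blast
  qed
qed

end

section \<open>Iterated power sets of the second cardinal\<close>

lemma kpair_in_VPow: "u \<in> elts x \<Longrightarrow> v \<in> elts x \<Longrightarrow> kpair u v \<in> elts (VPow (VPow x))"
  by simp

lemma small_Pset [simp]: "small (Pset \<kappa> \<mu>)"
  by (rule small_subset[OF small_Pow[of \<mu>]]) (auto simp: Pset_def)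

lemma small_subset_Pset: "X \<subseteq> Pset \<kappa> \<mu> \<Longrightarrow> small X"
  using small_subset[OF small_Pset] .

text \<open>A bijection between a subset of \<open>\<mu>\<close> and an ordinal below \<open>\<kappa>\<close> is a set of pairs of elements of \<open>\<mu>\<close>,
  and a pair lies two power sets above its components. Hence \<open>H\<close> contains all the bijections that
  could witness smallness.\<close>

lemma Pset_rel_eq_Pset:
  assumes "Ord \<mu>" "elts \<kappa> \<subseteq> elts \<mu>" "elts (VPow (VPow (VPow \<mu>))) \<subseteq> H"
  shows "Pset_rel H \<kappa> \<mu> = Pset \<kappa> \<mu>"
proof (intro equalityI subsetI)
  fix a assume "a \<in> Pset_rel H \<kappa> \<mu>"
  then obtain \<beta> f where "elts a \<subseteq> elts \<mu>" "\<beta> \<in> elts \<kappa>" "bijection_set f a \<beta>"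
    unfolding Pset_rel_def by blast
  then show "a \<in> Pset \<kappa> \<mu>"
    unfolding Pset_def card_less_def bijection_set_def eqpoll_def by blast
next
  fix a assume "a \<in> Pset \<kappa> \<mu>"
  then obtain \<beta> g where a: "elts a \<subseteq> elts \<mu>" and \<beta>: "\<beta> \<in> elts \<kappa>" and g: "bij_betw g (elts a) (elts \<beta>)"
    unfolding Pset_def card_less_def eqpoll_def by blast
  have T: "Transset \<mu>" "Transset (VPow \<mu>)" "Transset (VPow (VPow \<mu>))"
    using assms(1) Transset_VPow by (auto simp: Ord_def)
  let ?f = "vset ((\<lambda>u. kpair u (g u)) ` elts a)"
  have f: "elts ?f = (\<lambda>u. kpair u (g u)) ` elts a" by simp
  have "g u \<in> elts \<mu>" if "u \<in> elts a" for u
    using that g \<beta> assms(1,2) Ord_trans[OF assms(1), of \<beta>] by (auto simp: bij_betw_def)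
  then have "elts ?f \<subseteq> elts (VPow (VPow \<mu>))"
    unfolding f using kpair_in_VPow a by blast
  then have "?f \<in> H"
    using assms(3) by (subst (asm) elts_VPow) blast
  moreover have "bijection_set ?f a \<beta>"
    unfolding bijection_set_def using f g by blast
  moreover have "a \<in> H"
  proof -
    have "a \<in> elts (VPow \<mu>)" using a by simp
    then show ?thesis using assms(3) VPow_increasing T by blast
  qed
  ultimately show "a \<in> Pset_rel H \<kappa> \<mu>"
    unfolding Pset_rel_def using a \<beta> by blast
qed

section \<open>Normal ultrafilters coded in a transitive class\<close>

text \<open>The element \<open>W\<close> codes a normal ultrafilter on \<open>S\<close> from the point of view of \<open>N\<close>. The conjuncts are:
  the members are nonempty subsets of \<open>S\<close>; closure under supersets of intersections; the
  ultrafilter property; fineness; almost every \<open>a\<close> includes a given \<open>\<beta> \<in> \<kappa>\<close>; and normality. The fifth conjunct stands in for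
  \<open>\<kappa>\<close>-completeness, which would require quantifying over families, and follows from it by normality:
  a function into \<open>\<beta>\<close> is regressive on the sets including \<open>\<beta>\<close>. In the normality clause \<open>R\<close> is any
  relation, which avoids saying that a set of pairs is a function.\<close>

definition normal_code :: "'v::zfc_universe set \<Rightarrow> 'v \<Rightarrow> 'v \<Rightarrow> 'v \<Rightarrow> 'v \<Rightarrow> bool" where
  "normal_code N W S \<kappa> \<mu> \<longleftrightarrow>
     (\<forall>X\<in>elts W. elts X \<subseteq> elts S \<and> elts X \<noteq> {}) \<and>
     (\<forall>X\<in>elts W. \<forall>Y\<in>elts W. \<forall>Z\<in>N.
        elts Z \<subseteq> elts S \<and> elts X \<inter> elts Y \<subseteq> elts Z \<longrightarrow> Z \<in> elts W) \<and>
     (\<forall>X\<in>N. elts X \<subseteq> elts S \<longrightarrow> X \<in> elts W \<or> (\<exists>Y\<in>elts W. elts X \<inter> elts Y = {})) \<and>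
     (\<forall>\<gamma>\<in>elts \<mu>. \<exists>Y\<in>elts W. \<forall>a\<in>elts Y. \<gamma> \<in> elts a) \<and>
     (\<forall>\<beta>\<in>elts \<kappa>. \<exists>Y\<in>elts W. \<forall>a\<in>elts Y. elts \<beta> \<subseteq> elts a) \<and>
     (\<forall>R\<in>N. \<forall>T\<in>elts W. (\<forall>a\<in>elts T. \<exists>\<gamma>\<in>elts a. kpair a \<gamma> \<in> elts R) \<longrightarrow>
        (\<exists>\<gamma>\<in>elts \<mu>. \<exists>Y\<in>elts W. \<forall>a\<in>elts Y. kpair a \<gamma> \<in> elts R))"

definition normal_fm :: fm where
  "normal_fm =
     Conj (FAllIn 5 0 (Conj (FAllIn 6 5 (Member 6 2)) (FExIn 6 5 (Equal 6 6))))
    (Conj (FAllIn 5 0 (FAllIn 6 0 (Forall 7 (FImp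
        (Conj (FAllIn 8 7 (Member 8 2)) (FAllIn 8 5 (FImp (Member 8 6) (Member 8 7))))
        (Member 7 0)))))
    (Conj (Forall 5 (FImp (FAllIn 6 5 (Member 6 2))
        (FOr (Member 5 0) (FExIn 6 0 (FAllIn 7 6 (Neg (Member 7 5)))))))
    (Conj (FAllIn 5 4 (FExIn 6 0 (FAllIn 7 6 (Member 5 7))))
    (Conj (FAllIn 5 3 (FExIn 6 0 (FAllIn 7 6 (FAllIn 8 5 (Member 8 7)))))
          (Forall 5 (FAllIn 6 0 (FImp
             (FAllIn 7 6 (FExIn 8 7 (in_pair_fm 5 7 8)))
             (FExIn 7 4 (FExIn 8 0 (FAllIn 9 8 (in_pair_fm 5 9 7)))))))))))"

lemma satisfies_normal_fm:
  assumes "transitive N" "W \<in> N" "S \<in> N" "\<kappa> \<in> N" "\<mu> \<in> N"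
  shows "satisfies N normal_fm ((\<lambda>_. W)(2 := S, 3 := \<kappa>, 4 := \<mu>)) \<longleftrightarrow> normal_code N W S \<kappa> \<mu>"
proof -
  note D = transitiveD[OF assms(1)]
  have D2: "x \<in> N" if "x \<in> elts y" "y \<in> elts z" "z \<in> N" for x y z
    using D that by blast
  have D3: "x \<in> N" if "x \<in> elts y" "y \<in> elts z" "z \<in> elts w" "w \<in> N" for x y z w
    using D that by blast
  have i: "(\<forall>u\<in>elts x. u \<in> elts y) \<longleftrightarrow> elts x \<subseteq> elts y"
    "(\<exists>u. u \<in> elts x) \<longleftrightarrow> elts x \<noteq> {}"
    "(\<forall>u\<in>elts x. u \<in> elts y \<longrightarrow> u \<in> elts z) \<longleftrightarrow> elts x \<inter> elts y \<subseteq> elts z"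
    "(\<forall>u\<in>elts x. u \<notin> elts y) \<longleftrightarrow> elts y \<inter> elts x = {}" for x y z :: 'a
    by auto
  show ?thesis
    unfolding normal_fm_def normal_code_def
    using assms D[OF assms(2)] D[OF assms(4)] D[OF assms(5)] D2[OF _ _ assms(2)] D3[OF _ _ _ assms(2)]
    by (simp add: i cong: ball_cong_simp bex_cong_simp)
qed

text \<open>Subsets of \<open>P\<^sub>\<kappa>(\<mu>)\<close> lie in the second iterated power set of \<open>\<mu>\<close> and functions from \<open>P\<^sub>\<kappa>(\<mu>)\<close> to \<open>\<mu>\<close> in the fourth.
  So a class \<open>H\<close> that includes the fourth power set sees all the sets over which the definition of a
  normal ultrafilter quantifies.\<close>

lemma supercompact_of_code:
  assumes \<kappa>: "Card \<kappa>" "uncountable (elts \<kappa>)" and \<mu>: "Ord \<mu>" "elts \<kappa> \<subseteq> elts \<mu>"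
    and H: "elts (VPow (VPow (VPow (VPow \<mu>)))) \<subseteq> H"
    and S: "elts S = Pset \<kappa> \<mu>" and code: "normal_code H W S \<kappa> \<mu>"
  shows "supercompact \<kappa> \<mu>"
proof -
  define U where "U = elts ` elts W"
  note c = code[unfolded normal_code_def S]
  note c1 = c[THEN conjunct1] and c2 = c[THEN conjunct2, THEN conjunct1]
    and c3 = c[THEN conjunct2, THEN conjunct2, THEN conjunct1]
    and c4 = c[THEN conjunct2, THEN conjunct2, THEN conjunct2, THEN conjunct1]
    and c5 = c[THEN conjunct2, THEN conjunct2, THEN conjunct2, THEN conjunct2, THEN conjunct1]
    and c6 = c[THEN conjunct2, THEN conjunct2, THEN conjunct2, THEN conjunct2, THEN conjunct2]
  have T: "Transset \<mu>" "Transset (VPow \<mu>)" "Transset (VPow (VPow \<mu>))" "Transset (VPow (VPow (VPow \<mu>)))"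
    using \<mu>(1) Transset_VPow by (auto simp: Ord_def)
  have vs: "elts (vset X) = X" if "X \<subseteq> Pset \<kappa> \<mu>" for X
    using small_subset_Pset[OF that] by simp
  have inU: "X \<in> U \<longleftrightarrow> vset X \<in> elts W" if "X \<subseteq> Pset \<kappa> \<mu>" for X
    unfolding U_def using vs[OF that] by (metis imageE image_eqI vset_elts)
  have inH: "vset X \<in> H" if "X \<subseteq> Pset \<kappa> \<mu>" for X
  proof -
    have "vset X \<in> elts (VPow (VPow \<mu>))"
      using that vs[OF that] by (auto simp: Pset_def)
    then show ?thesis using VPow_increasing T H by blast
  qed
  have U_sub: "X \<subseteq> Pset \<kappa> \<mu>" "X \<noteq> {}" if "X \<in> U" for X
    using that c1 unfolding U_def by auto
  have up: "Z \<in> U" if "X \<in> U" "Y \<in> U" "X \<inter> Y \<subseteq> Z" "Z \<subseteq> Pset \<kappa> \<mu>" for X Y Z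
  proof -
    have "vset X \<in> elts W" "vset Y \<in> elts W" using inU U_sub that by blast+
    then have "vset Z \<in> elts W"
      using c2 inH[OF that(4)] vs U_sub(1) that by metis
    then show ?thesis using inU that by blast
  qed
  have up1: "Z \<in> U" if "Y \<in> elts W" "elts Y \<subseteq> Z" "Z \<subseteq> Pset \<kappa> \<mu>" for Y Z
    using up[of "elts Y" "elts Y" Z] that by (auto simp: U_def)
  have ultra: "X \<in> U \<or> Pset \<kappa> \<mu> - X \<in> U" if X: "X \<subseteq> Pset \<kappa> \<mu>" for X
  proof (cases "X \<in> U")
    case False
    then have "vset X \<notin> elts W" using inU X by blast
    then obtain Y where Y: "Y \<in> elts W" "X \<inter> elts Y = {}"
      using c3 inH[OF X] vs[OF X] X by metis
    moreover have "elts Y \<subseteq> Pset \<kappa> \<mu>" using Y U_sub unfolding U_def by blast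
    ultimately show ?thesis using up1[OF Y(1), of "Pset \<kappa> \<mu> - X"] by blast
  qed simp
  have PU: "Pset \<kappa> \<mu> \<in> U"
    using ultra[of "Pset \<kappa> \<mu>"] up[of "{}" "{}" "Pset \<kappa> \<mu>"] by auto
  have filter: "ultrafilter_on (Pset \<kappa> \<mu>) U"
    unfolding ultrafilter_on_def
  proof (intro conjI ballI allI impI)
    show "U \<subseteq> Pow (Pset \<kappa> \<mu>)" "{} \<notin> U" using U_sub by blast+
    show "X \<inter> Y \<in> U" if "X \<in> U" "Y \<in> U" for X Y
      using up[OF that, of "X \<inter> Y"] U_sub(1)[OF that(1)] by blast
    show "Y \<in> U" if "X \<in> U" "X \<subseteq> Y \<and> Y \<subseteq> Pset \<kappa> \<mu>" for X Y
      using up[OF that(1) that(1), of Y] that(2) by blast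
  qed (use PU ultra in auto)
  have fine: "fine_family \<kappa> \<mu> U"
    unfolding fine_family_def
  proof
    fix \<gamma> assume "\<gamma> \<in> elts \<mu>"
    then obtain Y where Y: "Y \<in> elts W" "\<And>a. a \<in> elts Y \<Longrightarrow> \<gamma> \<in> elts a" using bspec[OF c4] by blast
    have "elts Y \<subseteq> Pset \<kappa> \<mu>" using U_sub(1)[of "elts Y"] Y(1) by (auto simp: U_def)
    then show "{a \<in> Pset \<kappa> \<mu>. \<gamma> \<in> elts a} \<in> U"
      by (intro up1[OF Y(1)]) (use Y(2) in blast)+
  qed
  have normal: "normal_family \<kappa> \<mu> U"
    unfolding normal_family_def
  proof (intro allI impI)
    fix f assume f: "{a \<in> Pset \<kappa> \<mu>. f a \<in> elts a} \<in> U" (is "?T \<in> U")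
    have TP: "?T \<subseteq> Pset \<kappa> \<mu>" by blast
    let ?R = "vset ((\<lambda>a. kpair a (f a)) ` ?T)"
    have R: "elts ?R = (\<lambda>a. kpair a (f a)) ` ?T"
      using small_subset_Pset[OF TP] by simp
    have "kpair a (f a) \<in> elts (VPow (VPow (VPow \<mu>)))" if "a \<in> ?T" for a
      by (rule kpair_in_VPow) (use that VPow_increasing[OF T(1), of "f a"] in \<open>auto simp: Pset_def\<close>)
    then have "elts ?R \<subseteq> elts (VPow (VPow (VPow \<mu>)))" unfolding R by blast
    then have "?R \<in> H" using H by (subst (asm) elts_VPow) blast
    moreover have "vset ?T \<in> elts W" using f inU[OF TP] by blast
    moreover have "\<forall>a\<in>elts (vset ?T). \<exists>\<gamma>\<in>elts a. kpair a \<gamma> \<in> elts ?R"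
      unfolding vs[OF TP] R by blast
    ultimately have "\<exists>\<gamma>\<in>elts \<mu>. \<exists>Y\<in>elts W. \<forall>a\<in>elts Y. kpair a \<gamma> \<in> elts ?R"
      using c6[rule_format, of ?R "vset ?T"] by simp
    then obtain \<gamma> Y where \<gamma>: "\<gamma> \<in> elts \<mu>" and Y: "Y \<in> elts W"
      and eq: "\<And>a. a \<in> elts Y \<Longrightarrow> kpair a \<gamma> \<in> elts ?R"
      by blast
    have "f a = \<gamma>" "a \<in> Pset \<kappa> \<mu>" if "a \<in> elts Y" for a
      using eq[OF that] unfolding R by auto
    then have "{a \<in> Pset \<kappa> \<mu>. f a = \<gamma>} \<in> U" by (intro up1[OF Y]) auto
    with \<gamma> show "\<exists>\<gamma>\<in>elts \<mu>. {a \<in> Pset \<kappa> \<mu>. f a = \<gamma>} \<in> U" by blast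
  qed
  have complete: "complete_family \<kappa> U"
    unfolding complete_family_def
  proof (intro allI impI)
    fix F assume F: "F \<subseteq> U \<and> F \<noteq> {} \<and> card_less F \<kappa>"
    then obtain \<beta> g where \<beta>: "\<beta> \<in> elts \<kappa>" and g: "bij_betw g (elts \<beta>) F"
      unfolding card_less_def by (metis eqpoll_sym eqpoll_def)
    then have F_eq: "F = g ` elts \<beta>" by (simp add: bij_betw_def)
    have sub: "\<Inter>F \<subseteq> Pset \<kappa> \<mu>" using F U_sub by blast
    \<comment> \<open>Otherwise almost every \<open>a\<close> misses a member of the family. The index of such a member is below
      \<open>\<beta>\<close>, hence in \<open>a\<close> for almost every \<open>a\<close>, so by normality one member is almost always missed.\<close>
    show "\<Inter>F \<in> U"
    proof (rule ccontr)
      assume "\<Inter>F \<notin> U"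
      then have T1: "Pset \<kappa> \<mu> - \<Inter>F \<in> U" using ultra[OF sub] by blast
      obtain Y where Y: "Y \<in> elts W" "\<And>a. a \<in> elts Y \<Longrightarrow> elts \<beta> \<subseteq> elts a"
        using bspec[OF c5 \<beta>] by blast
      have YU: "elts Y \<in> U" using Y by (simp add: U_def)
      define T where "T = (Pset \<kappa> \<mu> - \<Inter>F) \<inter> elts Y"
      have TU: "T \<in> U" unfolding T_def using up[OF T1 YU] by blast
      define f where "f a = (SOME \<gamma>. \<gamma> \<in> elts \<beta> \<and> a \<notin> g \<gamma>)" for a
      have f: "f a \<in> elts \<beta>" "a \<notin> g (f a)" if "a \<in> T" for a
      proof -
        have "\<exists>\<gamma>. \<gamma> \<in> elts \<beta> \<and> a \<notin> g \<gamma>" using that unfolding T_def F_eq by blast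
        from someI_ex[OF this] show "f a \<in> elts \<beta>" "a \<notin> g (f a)" unfolding f_def by blast+
      qed
      have "T \<subseteq> {a \<in> Pset \<kappa> \<mu>. f a \<in> elts a}"
        using f Y(2) unfolding T_def by blast
      then have "{a \<in> Pset \<kappa> \<mu>. f a \<in> elts a} \<in> U" using up[OF TU TU] by blast
      then obtain \<gamma> where "{a \<in> Pset \<kappa> \<mu>. f a = \<gamma>} \<in> U"
        using normal unfolding normal_family_def by blast
      then have V: "T \<inter> {a \<in> Pset \<kappa> \<mu>. f a = \<gamma>} \<in> U" (is "?V \<in> U")
        using up[OF TU, of "{a \<in> Pset \<kappa> \<mu>. f a = \<gamma>}" ?V] by blast
      then have "\<gamma> \<in> elts \<beta>" using f U_sub(2)[OF V] by blast
      then have "g \<gamma> \<in> U" using F F_eq by blast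
      then have "?V \<inter> g \<gamma> \<in> U" using up[OF V, of "g \<gamma>" "?V \<inter> g \<gamma>"] by blast
      then have "?V \<inter> g \<gamma> \<noteq> {}" using U_sub(2) by blast
      then show False using f by blast
    qed
  qed
  from filter complete fine normal \<kappa> show ?thesis unfolding supercompact_def by blast
qed

section \<open>The critical point\<close>

lemma crit_eqI:
  assumes "c \<in> M" "Ord c" "c \<in> elts (j c)"
    and least: "\<And>\<beta>. \<beta> \<in> M \<Longrightarrow> Ord \<beta> \<Longrightarrow> \<beta> \<in> elts (j \<beta>) \<Longrightarrow> elts c \<subseteq> elts \<beta>"
  shows "crit j M = c"
  unfolding crit_def
proof (rule the_equality)
  fix \<alpha> assume \<alpha>: "\<alpha> \<in> M \<and> Ord \<alpha> \<and> \<alpha> \<in> elts (j \<alpha>) \<and>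
     (\<forall>\<beta>\<in>M. Ord \<beta> \<and> \<beta> \<in> elts (j \<beta>) \<longrightarrow> elts \<alpha> \<subseteq> elts \<beta>)"
  then have "elts \<alpha> = elts c" using least assms(1-3) by (intro equalityI) blast+
  then show "\<alpha> = c" by (rule extensionality)
qed (use assms in blast)

lemma crit_least:
  assumes "nontrivial j M"
  shows "crit j M \<in> M" "Ord (crit j M)" "crit j M \<in> elts (j (crit j M))"
    and "\<And>\<beta>. \<beta> \<in> M \<Longrightarrow> Ord \<beta> \<Longrightarrow> \<beta> \<in> elts (j \<beta>) \<Longrightarrow> elts (crit j M) \<subseteq> elts \<beta>"
proof -
  obtain \<alpha> where "Ord \<alpha>" "\<alpha> \<in> M \<and> \<alpha> \<in> elts (j \<alpha>)"
    using assms unfolding nontrivial_def by blast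
  then obtain c where c: "Ord c" "c \<in> M \<and> c \<in> elts (j c)"
    "\<And>\<beta>. Ord \<beta> \<Longrightarrow> \<beta> \<in> M \<and> \<beta> \<in> elts (j \<beta>) \<Longrightarrow> elts c \<subseteq> elts \<beta>"
    by (rule least_Ord[where P = "\<lambda>\<alpha>. \<alpha> \<in> M \<and> \<alpha> \<in> elts (j \<alpha>)"]) blast
  then have "crit j M = c" by (intro crit_eqI) auto
  with c show "crit j M \<in> M" "Ord (crit j M)" "crit j M \<in> elts (j (crit j M))"
    "\<And>\<beta>. \<beta> \<in> M \<Longrightarrow> Ord \<beta> \<Longrightarrow> \<beta> \<in> elts (j \<beta>) \<Longrightarrow> elts (crit j M) \<subseteq> elts \<beta>" by auto
qed

section \<open>From a small embedding to a normal ultrafilter\<close>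

text \<open>The situation of a small embedding whose derived family is an element \<open>D\<close> of its domain, with
  \<open>\<theta>\<close> large enough for \<open>supercompact_of_code\<close>.\<close>

locale reflecting_embedding =
  fixes \<kappa> \<mu> \<theta> M \<delta> D :: "'v::zfc_universe" and j :: "'v \<Rightarrow> 'v"
  assumes Card_\<kappa>: "Card \<kappa>" and Card_\<mu>: "Card \<mu>" and \<kappa>_le_\<mu>: "elts \<kappa> \<subseteq> elts \<mu>"
    and small_embedding: "small_embedding \<kappa> \<theta> M j"
    and \<delta>_in_M: "\<delta> \<in> elts M" and \<delta>_in_\<kappa>: "\<delta> \<in> elts \<kappa>" and j_\<delta>: "j \<delta> = \<mu>"
    and D_in_M: "D \<in> elts M" and elts_D: "elts D = derived_family j M \<delta>"
    and powers: "elts (VPow (VPow (VPow (VPow \<mu>)))) \<subseteq> Hset \<theta>"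

sublocale reflecting_embedding \<subseteq> transitive_embedding j "elts M" "Hset \<theta>"
proof
  have "Ord \<theta>" using small_embedding Card_Ord unfolding small_embedding_def by blast
  show "transitive (elts M)"
    using small_embedding by (auto simp: small_embedding_def Transset_def transitive_def)
  show "transitive (Hset \<theta>)"
    unfolding transitive_def using Hset_mem[OF \<open>Ord \<theta>\<close>] by blast
  show "elementary_embedding j (elts M) (Hset \<theta>)"
    using small_embedding by (auto simp: small_embedding_def)
  show "y \<in> Hset \<theta>" if "x \<in> Hset \<theta>" "elts y \<subseteq> elts x" for x y
    by (rule Hset_subset[OF \<open>Ord \<theta>\<close> that])
qed

context reflecting_embedding
begin

abbreviation "c \<equiv> crit j (elts M)"

lemma j_c: "j c = \<kappa>" and nontrivial: "nontrivial j (elts M)"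
  using small_embedding by (auto simp: small_embedding_def)

lemmas c_least = crit_least[OF nontrivial]

lemma c_in_M: "c \<in> elts M" and Ord_c: "Ord c" and c_in_\<kappa>: "c \<in> elts \<kappa>"
  using c_least(1-3) j_c by auto

lemma in_M: "x \<in> elts M" if "y \<in> elts M" "x \<in> elts y"
  using transitiveD[OF transitive_M] that by blast

lemma Ord_\<kappa>: "Ord \<kappa>" and Ord_\<mu>: "Ord \<mu>"
  using Card_\<kappa> Card_\<mu> Card_Ord by auto

text \<open>By leastness of the critical point \<open>\<beta> \<notin> j(\<beta>)\<close>, and \<open>j(\<beta>) \<in> \<beta>\<close> would give \<open>j(j(\<beta>)) = j(\<beta>)\<close> by
  induction, against injectivity.\<close>

lemma j_below_crit: "\<beta> \<in> elts c \<Longrightarrow> j \<beta> = \<beta>"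
proof (induction \<beta> rule: mem_induct)
  case (mem \<beta>)
  note \<beta> = in_M[OF c_in_M mem.prems] Ord_mem[OF Ord_c mem.prems]
  have "j \<beta> \<in> elts \<kappa>"
    using j_mem_iff[OF \<beta>(1) c_in_M] mem.prems j_c by simp
  then have "Ord (j \<beta>)" using Ord_mem Ord_\<kappa> by blast
  moreover have "\<beta> \<notin> elts (j \<beta>)"
    using c_least(4)[OF \<beta>] mem.prems mem_irrefl by blast
  moreover have "j \<beta> \<notin> elts \<beta>"
  proof
    assume b: "j \<beta> \<in> elts \<beta>"
    then have "j (j \<beta>) = j \<beta>" using mem.IH Ord_trans[OF Ord_c mem.prems] by blast
    then have "j \<beta> = \<beta>" using j_eq_iff[OF in_M[OF \<beta>(1) b] \<beta>(1)] by simp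
    with b show False using mem_irrefl[of \<beta>] by simp
  qed
  ultimately show ?case using Ord_linear[OF \<beta>(2), of "j \<beta>"] by metis
qed

lemma c_subset_\<delta>: "elts c \<subseteq> elts \<delta>"
  using j_subset_iff[OF c_in_M \<delta>_in_M] j_c j_\<delta> \<kappa>_le_\<mu> by simp

text \<open>The empty set and the successor of a fixed ordinal are definable from fixed parameters, hence
  fixed. So \<open>c\<close> is neither zero nor the successor of one of its elements.\<close>

lemma infinite_c: "infinite (elts c)"
proof
  assume fin: "finite (elts c)"
  show False
  proof (cases "elts c = {}")
    case True
    have "elts (j c) = {}"
      using transfer[OF c_in_M c_in_M c_in_M c_in_M, of "FAllIn 5 0 (Neg (Equal 5 5))"]
        True transitive_M transitive_H c_in_M by simp
    with c_in_\<kappa> j_c show False by simp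
  next
    case False
    have asym: "asymp_on (elts c) (\<lambda>x y. x \<in> elts y)"
      using mem_asym by (intro asymp_onI) blast
    have trans: "transp_on (elts c) (\<lambda>x y. x \<in> elts y)"
      using Ord_trans Ord_mem[OF Ord_c] by (intro transp_onI) blast
    obtain d where d: "d \<in> elts c" "\<And>x. x \<in> elts c \<Longrightarrow> x \<noteq> d \<Longrightarrow> d \<notin> elts x"
      using Finite_Set.bex_max_element[OF fin asym trans False] by blast
    have "elts c = insert d (elts d)"
      using d Ord_linear Ord_mem[OF Ord_c] Ord_trans[OF Ord_c d(1)] by blast
    then have "\<forall>x\<in>elts M. x \<in> elts c \<longleftrightarrow> x \<in> elts d \<or> x = d" by auto
    then have "\<forall>x\<in>Hset \<theta>. x \<in> elts (j c) \<longleftrightarrow> x \<in> elts (j d) \<or> x = j d"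
      using transfer[OF c_in_M in_M[OF c_in_M d(1)] c_in_M c_in_M,
          of "Forall 5 (FIff (Member 5 0) (FOr (Member 5 2) (Equal 5 2)))"] by simp
    moreover have "c \<in> elts (j c)" using c_in_\<kappa> j_c by simp
    moreover from this have "c \<in> Hset \<theta>" by (rule transitiveD[OF transitive_H j_in_H[OF c_in_M]])
    ultimately have "c \<in> elts (j d) \<or> c = j d" by blast
    then have "c \<in> elts d \<or> c = d" using j_below_crit[OF d(1)] by simp
    with d(1) show False using mem_asym mem_irrefl by blast
  qed
qed

text \<open>The cardinal \<open>\<kappa>\<close> has the infinite element \<open>c\<close>.\<close>

lemma uncountable_\<kappa>: "uncountable (elts \<kappa>)"
proof
  assume "countable (elts \<kappa>)"
  then have "elts \<kappa> \<lesssim> (UNIV :: nat set)" unfolding countable_def lepoll_def by blast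
  also have "(UNIV :: nat set) \<lesssim> elts c" using infinite_c infinite_le_lepoll by blast
  finally show False using Card_not_lepoll_mem[OF Card_\<kappa> c_in_\<kappa>] by blast
qed

text \<open>The set \<open>j[\<delta>]\<close>, from which \<open>D\<close> is derived.\<close>

definition seed :: 'v where "seed = vset (j ` elts \<delta>)"

lemma elts_seed: "elts seed = j ` elts \<delta>"
  by (simp add: seed_def)

lemma seed_in_Pset: "seed \<in> Pset \<kappa> \<mu>"
proof -
  have "j ` elts \<delta> \<subseteq> elts \<mu>"
    using j_mem_iff[OF in_M[OF \<delta>_in_M] \<delta>_in_M] j_\<delta> by auto
  moreover have "inj_on j (elts \<delta>)"
    using j_eq_iff in_M[OF \<delta>_in_M] by (auto intro: inj_onI)
  then have "j ` elts \<delta> \<approx> elts \<delta>" by (rule inj_on_image_eqpoll_self)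
  ultimately show ?thesis
    using \<delta>_in_\<kappa> by (auto simp: Pset_def card_less_def elts_seed)
qed

lemma mem_D_iff:
  "A \<in> elts D \<longleftrightarrow> A \<in> elts M \<and> elts A \<subseteq> Pset_rel (elts M) c \<delta> \<and> seed \<in> elts (j A)"
proof -
  have "elts seed \<in> elts ` X \<longleftrightarrow> seed \<in> X" for X
    using extensionality by (metis imageE image_eqI)
  then show ?thesis
    unfolding elts_D derived_family_def PowPset_rel_def elts_seed[symmetric] by auto
qed

lemma Pset_rel_H: "Pset_rel (Hset \<theta>) \<kappa> \<mu> = Pset \<kappa> \<mu>"
proof (rule Pset_rel_eq_Pset[OF Ord_\<mu> \<kappa>_le_\<mu>])
  have "Transset (VPow (VPow (VPow \<mu>)))" using Ord_\<mu> Transset_VPow by (auto simp: Ord_def)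
  then show "elts (VPow (VPow (VPow \<mu>))) \<subseteq> Hset \<theta>" using VPow_increasing powers by blast
qed

text \<open>\<open>H(\<theta>)\<close> satisfies that \<open>P\<^sub>\<kappa>(\<mu>)\<close> exists, so \<open>M\<close> has a preimage of it, which is its own version of
  \<open>P\<^sub>c(\<delta>)\<close>.\<close>

lemma Pset_in_M:
  obtains S where "S \<in> elts M" "elts S = Pset_rel (elts M) c \<delta>" "elts (j S) = Pset \<kappa> \<mu>"
proof -
  let ?\<chi> = "Forall 0 (FIff (Member 0 5) (Pset_fm 0 2 3))"
  have sat: "satisfies N ?\<chi> ((\<lambda>_. y)(2 := u, 3 := v, 4 := w)) \<longleftrightarrow>
    (\<forall>a\<in>N. a \<in> elts y \<longleftrightarrow> a \<in> Pset_rel N u v)" if "transitive N" "u \<in> N" for N y u v w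
    using that by simp
  have sat5: "satisfies N (FEx 5 ?\<chi>) ((\<lambda>_. u)(2 := u, 3 := v, 4 := u)) \<longleftrightarrow>
    (\<exists>y\<in>N. \<forall>a\<in>N. a \<in> elts y \<longleftrightarrow> a \<in> Pset_rel N u v)" if "transitive N" "u \<in> N" for N u v
    using that by simp
  have P_H: "Pset \<kappa> \<mu> \<subseteq> Hset \<theta>" using Pset_rel_H unfolding Pset_rel_def by blast
  have T: "Transset (VPow (VPow \<mu>))" "Transset (VPow (VPow (VPow \<mu>)))"
    using Ord_\<mu> Transset_VPow by (auto simp: Ord_def)
  have "Pset \<kappa> \<mu> \<subseteq> elts (VPow \<mu>)" by (auto simp: Pset_def)
  then have "vset (Pset \<kappa> \<mu>) \<in> elts (VPow (VPow \<mu>))" by simp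
  then have "vset (Pset \<kappa> \<mu>) \<in> Hset \<theta>" using VPow_increasing T powers by blast
  moreover have "elts (vset (Pset \<kappa> \<mu>)) = Pset_rel (Hset \<theta>) (j c) (j \<delta>)"
    by (simp add: j_c j_\<delta> Pset_rel_H)
  ultimately have "satisfies (Hset \<theta>) (FEx 5 ?\<chi>) ((\<lambda>_. j c)(2 := j c, 3 := j \<delta>, 4 := j c))"
    unfolding sat5[OF transitive_H j_in_H[OF c_in_M]] by blast
  then have "satisfies (elts M) (FEx 5 ?\<chi>) ((\<lambda>_. c)(2 := c, 3 := \<delta>, 4 := c))"
    using transfer[OF c_in_M c_in_M \<delta>_in_M c_in_M] by blast
  then obtain S where S: "S \<in> elts M" "\<And>a. a \<in> elts M \<Longrightarrow> a \<in> elts S \<longleftrightarrow> a \<in> Pset_rel (elts M) c \<delta>"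
    unfolding sat5[OF transitive_M c_in_M] by blast
  have "satisfies (elts M) ?\<chi> ((\<lambda>_. S)(2 := c, 3 := \<delta>, 4 := c))"
    unfolding sat[OF transitive_M c_in_M] using S(2) by blast
  then have "satisfies (Hset \<theta>) ?\<chi> ((\<lambda>_. j S)(2 := j c, 3 := j \<delta>, 4 := j c))"
    using transfer[OF S(1) c_in_M \<delta>_in_M c_in_M] by blast
  then have jS: "\<forall>a\<in>Hset \<theta>. a \<in> elts (j S) \<longleftrightarrow> a \<in> Pset \<kappa> \<mu>"
    unfolding sat[OF transitive_H j_in_H[OF c_in_M]] by (simp add: j_c j_\<delta> Pset_rel_H)
  show ?thesis
  proof (rule that[OF S(1)])
    show "elts S = Pset_rel (elts M) c \<delta>"
      using S in_M unfolding Pset_rel_def by blast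
    show "elts (j S) = Pset \<kappa> \<mu>"
      using jS P_H transitiveD[OF transitive_H j_in_H[OF S(1)]] by blast
  qed
qed

text \<open>The theorem of Los for the derived family: what \<open>H(\<theta>)\<close> says about the seed and parameters in the
  range of \<open>j\<close> holds in \<open>M\<close> on a set in \<open>D\<close>. Separation in \<open>M\<close> provides that set, and \<open>j\<close> maps it to
  the set that the same formula defines in \<open>H(\<theta>)\<close>, which contains the seed.\<close>

lemma derived_Los:
  assumes "p \<in> elts M" "q \<in> elts M" "fv \<phi> \<subseteq> {0, 2, 3}"
    and "satisfies (Hset \<theta>) \<phi> ((\<lambda>_. seed)(2 := j p, 3 := j q))"
  obtains Y where "Y \<in> elts D"
    "\<And>a. a \<in> elts Y \<Longrightarrow> satisfies (elts M) \<phi> ((\<lambda>_. a)(2 := p, 3 := q))"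
proof -
  obtain S where S: "S \<in> elts M" "elts S = Pset_rel (elts M) c \<delta>" "elts (j S) = Pset \<kappa> \<mu>"
    by (rule Pset_in_M)
  obtain Y where "Y \<in> elts M"
    "elts Y = {a \<in> elts S. satisfies (elts M) \<phi> ((\<lambda>_. a)(2 := p, 3 := q))}"
    "elts (j Y) = {a \<in> elts (j S). satisfies (Hset \<theta>) \<phi> ((\<lambda>_. a)(2 := j p, 3 := j q))}"
    by (rule separation_transfer[OF S(1) assms(1-3)])
  then show ?thesis
    using that[of Y] mem_D_iff assms(4) seed_in_Pset S by blast
qed

text \<open>Each clause is verified at the seed. Fineness holds because \<open>j(\<gamma>) \<in> j[\<delta>]\<close> for \<open>\<gamma> \<in> \<delta>\<close>, and the
  fifth clause because \<open>j\<close> fixes the elements of the critical point. For normality, a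
  regressive choice at the seed is an element of \<open>j[\<delta>]\<close>, that is \<open>j(\<gamma>)\<close> for a single \<open>\<gamma> \<in> \<delta>\<close>, and
  this \<open>\<gamma>\<close> works on a set in \<open>D\<close>.\<close>

lemma normal_code_M:
  assumes S: "S \<in> elts M" "elts S = Pset_rel (elts M) c \<delta>" "elts (j S) = Pset \<kappa> \<mu>"
  shows "normal_code (elts M) D S c \<delta>"
  unfolding normal_code_def
proof (intro conjI ballI impI)
  fix X assume "X \<in> elts D"
  then have X: "X \<in> elts M" "elts X \<subseteq> elts S" "seed \<in> elts (j X)"
    using mem_D_iff S(2) by blast+
  show "elts X \<subseteq> elts S" by (rule X)
  show "elts X \<noteq> {}"
    using transfer[OF X(1) X(1) X(1) X(1), of "FAllIn 5 0 (Neg (Equal 5 5))"]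
      X transitive_M transitive_H by auto
next
  fix X Y Z assume "X \<in> elts D" "Y \<in> elts D" and Z: "Z \<in> elts M"
    and sub: "elts Z \<subseteq> elts S \<and> elts X \<inter> elts Y \<subseteq> elts Z"
  then have X: "X \<in> elts M" "seed \<in> elts (j X)" and Y: "Y \<in> elts M" "seed \<in> elts (j Y)"
    using mem_D_iff by blast+
  have "seed \<in> elts (j Z)"
    using transfer[OF X(1) Y(1) Z Z, of "FAllIn 5 0 (FImp (Member 5 2) (Member 5 3))"]
      X Y Z sub transitive_M transitive_H by auto
  then show "Z \<in> elts D" using mem_D_iff Z sub S(2) by blast
next
  fix X assume X: "X \<in> elts M" "elts X \<subseteq> elts S"
  show "X \<in> elts D \<or> (\<exists>Y\<in>elts D. elts X \<inter> elts Y = {})"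
  proof (cases "seed \<in> elts (j X)")
    case True
    then show ?thesis using mem_D_iff X S(2) by blast
  next
    case False
    obtain Y where "Y \<in> elts D" "\<And>a. a \<in> elts Y \<Longrightarrow> a \<notin> elts X"
      by (rule derived_Los[OF X(1) X(1), of "Neg (Member 0 2)"]) (use False in auto)
    then show ?thesis by blast
  qed
next
  fix \<gamma> assume \<gamma>: "\<gamma> \<in> elts \<delta>"
  note M = in_M[OF \<delta>_in_M \<gamma>]
  obtain Y where "Y \<in> elts D" "\<And>a. a \<in> elts Y \<Longrightarrow> \<gamma> \<in> elts a"
    by (rule derived_Los[OF M M, of "Member 2 0"]) (use \<gamma> in \<open>auto simp: elts_seed\<close>)
  then show "\<exists>Y\<in>elts D. \<forall>a\<in>elts Y. \<gamma> \<in> elts a" by blast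
next
  fix \<beta> assume \<beta>: "\<beta> \<in> elts c"
  note M = in_M[OF c_in_M \<beta>]
  have "elts \<beta> \<subseteq> elts seed"
  proof
    fix z assume "z \<in> elts \<beta>"
    then have "z \<in> elts c" using Ord_trans[OF Ord_c \<beta>] by blast
    then show "z \<in> elts seed"
      using j_below_crit[of z] c_subset_\<delta> unfolding elts_seed by (metis image_eqI subsetD)
  qed
  moreover have "seed \<in> Hset \<theta>"
    using seed_in_Pset Pset_rel_H unfolding Pset_rel_def by blast
  ultimately have "satisfies (Hset \<theta>) (FAllIn 5 2 (Member 5 0)) ((\<lambda>_. seed)(2 := j \<beta>, 3 := j \<beta>))"
    using transitive_H M j_below_crit[OF \<beta>] j_in_H[OF M] by auto
  then obtain Y where Y: "Y \<in> elts D"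
    "\<And>a. a \<in> elts Y \<Longrightarrow> satisfies (elts M) (FAllIn 5 2 (Member 5 0)) ((\<lambda>_. a)(2 := \<beta>, 3 := \<beta>))"
    by (rule derived_Los[OF M M, rotated]) auto
  then have "\<forall>a\<in>elts Y. elts \<beta> \<subseteq> elts a" using transitive_M M by auto
  with Y show "\<exists>Y\<in>elts D. \<forall>a\<in>elts Y. elts \<beta> \<subseteq> elts a" by blast
next
  fix R T assume R: "R \<in> elts M" and "T \<in> elts D"
    and reg: "\<forall>a\<in>elts T. \<exists>\<gamma>\<in>elts a. kpair a \<gamma> \<in> elts R"
  then have T: "T \<in> elts M" "seed \<in> elts (j T)" using mem_D_iff by blast+
  have "\<forall>a\<in>elts (j T). \<exists>\<gamma>\<in>elts a. kpair a \<gamma> \<in> elts (j R)"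
    using transfer[OF R T(1) R R, of "FAllIn 7 2 (FExIn 8 7 (in_pair_fm 0 7 8))"]
      reg R T transitive_M transitive_H in_M[OF T(1)]
      transitiveD[OF transitive_H j_in_H[OF T(1)]]
    by (simp cong: ball_cong_simp bex_cong_simp)
  then have "\<exists>\<gamma>\<in>j ` elts \<delta>. kpair seed \<gamma> \<in> elts (j R)"
    using T(2) elts_seed by metis
  then obtain \<gamma> where \<gamma>: "\<gamma> \<in> elts \<delta>" "kpair seed (j \<gamma>) \<in> elts (j R)"
    by blast
  note M = in_M[OF \<delta>_in_M \<gamma>(1)]
  have sat: "satisfies N (in_pair_fm 2 0 3) ((\<lambda>_. a)(2 := r, 3 := g)) \<longleftrightarrow> kpair a g \<in> elts r"
    if "transitive N" "r \<in> N" for N a r g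
    using that by simp
  have fv: "fv (in_pair_fm 2 0 3) \<subseteq> {0, 2, 3}"
    by (auto simp: in_pair_fm_def pair_fm_def)
  have "satisfies (Hset \<theta>) (in_pair_fm 2 0 3) ((\<lambda>_. seed)(2 := j R, 3 := j \<gamma>))"
    using \<gamma>(2) sat[OF transitive_H j_in_H[OF R]] by blast
  then obtain Y where "Y \<in> elts D"
    "\<And>a. a \<in> elts Y \<Longrightarrow> satisfies (elts M) (in_pair_fm 2 0 3) ((\<lambda>_. a)(2 := R, 3 := \<gamma>))"
    using derived_Los[OF R M fv] by blast
  then show "\<exists>\<gamma>\<in>elts \<delta>. \<exists>Y\<in>elts D. \<forall>a\<in>elts Y. kpair a \<gamma> \<in> elts R"
    using sat[OF transitive_M R] \<gamma>(1) by blast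
qed

lemma supercompact_reflected: "supercompact \<kappa> \<mu>"
proof -
  obtain S where S: "S \<in> elts M" "elts S = Pset_rel (elts M) c \<delta>" "elts (j S) = Pset \<kappa> \<mu>"
    by (rule Pset_in_M)
  have "satisfies (elts M) normal_fm ((\<lambda>_. D)(2 := S, 3 := c, 4 := \<delta>))"
    using normal_code_M[OF S] satisfies_normal_fm[OF transitive_M D_in_M S(1) c_in_M \<delta>_in_M] by blast
  then have "satisfies (Hset \<theta>) normal_fm ((\<lambda>_. j D)(2 := j S, 3 := \<kappa>, 4 := \<mu>))"
    using transfer[OF D_in_M S(1) c_in_M \<delta>_in_M] j_c j_\<delta> by simp
  then have "normal_code (Hset \<theta>) (j D) (j S) \<kappa> \<mu>"
    using satisfies_normal_fm[OF transitive_H j_in_H[OF D_in_M] j_in_H[OF S(1)]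
        j_in_H[OF c_in_M] j_in_H[OF \<delta>_in_M]] j_c j_\<delta> by simp
  then show ?thesis
    by (rule supercompact_of_code[OF Card_\<kappa> uncountable_\<kappa> Ord_\<mu> \<kappa>_le_\<mu> powers S(3)])
qed

end

section \<open>Skolem terms\<close>

instance fm :: countable
  by countable_datatype

text \<open>The type of the parameters is left open so that terms over the natural numbers can serve as the
  countably many shapes of terms over the universe.\<close>

datatype 'a tm = Con nat | Par 'a | Sk fm nat "'a tm list"

instance tm :: (countable) countable
  by countable_datatype

text \<open>Choice of a witness for \<open>\<phi>\<close> in the variable \<open>n\<close>, where \<open>xs\<close> lists the values of the variables
  \<open>0, 1, \<dots>\<close>. The list has to cover the free variables of \<open>\<phi>\<close>, since lookup beyond its end is
  unspecified. If there is no witness, an arbitrary element \<open>d\<close> of \<open>H\<close> keeps the values inside \<open>H\<close>.\<close>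

definition skolem :: "'v::zfc_universe set \<Rightarrow> 'v \<Rightarrow> fm \<Rightarrow> nat \<Rightarrow> 'v list \<Rightarrow> 'v" where
  "skolem H d \<phi> n xs =
     (if \<exists>x\<in>H. satisfies H \<phi> ((\<lambda>i. xs ! i)(n := x))
      then SOME x. x \<in> H \<and> satisfies H \<phi> ((\<lambda>i. xs ! i)(n := x)) else d)"

primrec val :: "'v::zfc_universe set \<Rightarrow> (nat \<Rightarrow> 'v) \<Rightarrow> 'v tm \<Rightarrow> 'v" where
  "val H k (Con i) = k i"
| "val H k (Par x) = x"
| "val H k (Sk \<phi> n ts) = skolem H (k 0) \<phi> n (map (val H k) ts)"

definition hull :: "'v::zfc_universe set \<Rightarrow> (nat \<Rightarrow> 'v) \<Rightarrow> 'v set \<Rightarrow> 'v set" where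
  "hull H k A = val H k ` {t. set_tm t \<subseteq> A}"

lemma skolem_in: "d \<in> H \<Longrightarrow> skolem H d \<phi> n xs \<in> H"
  unfolding skolem_def
  using someI_ex[of "\<lambda>x. x \<in> H \<and> satisfies H \<phi> ((\<lambda>i. xs ! i)(n := x))"] by auto

lemma val_in:
  assumes "\<And>i. k i \<in> H"
  shows "set_tm t \<subseteq> H \<Longrightarrow> val H k t \<in> H"
  by (induction t) (auto simp: assms skolem_in)

lemma hull_subset: "(\<And>i. k i \<in> H) \<Longrightarrow> A \<subseteq> H \<Longrightarrow> hull H k A \<subseteq> H"
  unfolding hull_def using val_in by blast

lemma Con_in_hull: "k i \<in> hull H k A"
  unfolding hull_def by (rule image_eqI[of _ _ "Con i"]) auto

lemma Par_in_hull: "x \<in> A \<Longrightarrow> x \<in> hull H k A"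
  unfolding hull_def by (rule image_eqI[of _ _ "Par x"]) auto

text \<open>The Tarski-Vaught criterion, with the Skolem term for a counterexample to \<open>\<phi>\<close>.\<close>

lemma hull_elementary:
  assumes H: "\<And>i. k i \<in> H" "A \<subseteq> H"
  shows "range s \<subseteq> hull H k A \<Longrightarrow> satisfies (hull H k A) \<phi> s \<longleftrightarrow> satisfies H \<phi> s"
proof (induction \<phi> arbitrary: s)
  case (Forall n \<phi>)
  let ?X = "hull H k A"
  have IH: "satisfies ?X \<phi> (s(n := x)) \<longleftrightarrow> satisfies H \<phi> (s(n := x))" if "x \<in> ?X" for x
    by (rule Forall.IH) (use that Forall.prems in auto)
  have "satisfies H (Forall n \<phi>) s" if all: "\<forall>x\<in>?X. satisfies H \<phi> (s(n := x))"
  proof (rule ccontr)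
    assume "\<not> satisfies H (Forall n \<phi>) s"
    then obtain x where x: "x \<in> H" "\<not> satisfies H \<phi> (s(n := x))" by auto
    \<comment> \<open>Lists of length \<open>m\<close> cover the free variables of \<open>\<phi>\<close>; inserting 0 makes the maximum meaningful
      for closed formulas.\<close>
    define m where "m = Suc (Max (insert 0 (fv \<phi>)))"
    have m: "i < m" if "i \<in> fv \<phi>" for i
      unfolding m_def using that finite_fv[of \<phi>] by (simp add: less_Suc_eq_le)
    have "s i \<in> val H k ` {t. set_tm t \<subseteq> A}" for i
      using subsetD[OF Forall.prems rangeI, of i] unfolding hull_def .
    then have "\<forall>i. \<exists>t. set_tm t \<subseteq> A \<and> val H k t = s i"
      by (auto simp: image_iff) metis
    then obtain t where t: "\<And>i. set_tm (t i) \<subseteq> A" "\<And>i. val H k (t i) = s i" by metis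
    let ?ts = "map t [0..<m]"
    let ?xs = "map (val H k) ?ts"
    have eq: "satisfies H \<phi> ((\<lambda>i. ?xs ! i)(n := y)) \<longleftrightarrow> satisfies H \<phi> (s(n := y))" for y
      by (rule satisfies_cong) (auto simp: t(2) m)
    let ?y = "val H k (Sk (Neg \<phi>) n ?ts)"
    have "\<exists>x. x \<in> H \<and> satisfies H (Neg \<phi>) ((\<lambda>i. ?xs ! i)(n := x))"
      using x eq by auto
    from someI_ex[OF this] this have "\<not> satisfies H \<phi> ((\<lambda>i. ?xs ! i)(n := ?y))"
      by (auto simp: skolem_def)
    moreover have "?y \<in> ?X"
      unfolding hull_def by (rule imageI) (use t(1) in auto)
    ultimately show False using all eq by blast
  qed
  moreover have "?X \<subseteq> H" by (rule hull_subset[OF H])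
  ultimately show ?case using IH by auto
qed auto

section \<open>The number of Skolem terms\<close>

lemma infinite_times_lepoll: "infinite A \<Longrightarrow> A \<times> A \<lesssim> A"
  using card_of_Times_same_infinite eqpoll_iff_card_of_ordIso eqpoll_imp_lepoll by blast

lemma infinite_lists_lepoll:
  assumes "infinite A"
  shows "lists A \<lesssim> A"
proof -
  have "\<exists>f. inj_on f {xs \<in> lists A. length xs = n} \<and> f ` {xs \<in> lists A. length xs = n} \<subseteq> A" for n
  proof (induction n)
    case 0
    obtain a where "a \<in> A" using assms by fastforce
    then show ?case by (intro exI[of _ "\<lambda>_. a"]) (auto simp: inj_on_def)
  next
    case (Suc n)
    then obtain f where f: "inj_on f {xs \<in> lists A. length xs = n}" "f ` {xs \<in> lists A. length xs = n} \<subseteq> A"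
      by blast
    obtain g where g: "inj_on g (A \<times> A)" "g ` (A \<times> A) \<subseteq> A"
      using infinite_times_lepoll[OF assms] unfolding lepoll_def by blast
    let ?h = "\<lambda>xs. g (hd xs, f (tl xs))"
    have sp: "hd xs \<in> A" "tl xs \<in> {xs \<in> lists A. length xs = n}" "xs \<noteq> []"
      if "xs \<in> {xs \<in> lists A. length xs = Suc n}" for xs
      using that by (cases xs; auto)+
    have "inj_on ?h {xs \<in> lists A. length xs = Suc n}"
    proof (rule inj_onI)
      fix xs ys
      assume xs: "xs \<in> {xs \<in> lists A. length xs = Suc n}" and ys: "ys \<in> {xs \<in> lists A. length xs = Suc n}"
        and eq: "?h xs = ?h ys"
      have "(hd xs, f (tl xs)) = (hd ys, f (tl ys))"
        by (rule inj_onD[OF g(1) eq]) (use sp[OF xs] sp[OF ys] f(2) in blast)+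
      then have "hd xs = hd ys" "tl xs = tl ys"
        using inj_onD[OF f(1) _ sp(2)[OF xs] sp(2)[OF ys]] by auto
      then show "xs = ys" using sp(3)[OF xs] sp(3)[OF ys] list.expand by blast
    qed
    moreover have "?h ` {xs \<in> lists A. length xs = Suc n} \<subseteq> A"
    proof (rule image_subsetI)
      fix xs assume xs: "xs \<in> {xs \<in> lists A. length xs = Suc n}"
      have "f (tl xs) \<in> A" using imageI[OF sp(2)[OF xs], of f] f(2) by blast
      then show "?h xs \<in> A" using imageI[of "(hd xs, f (tl xs))" "A \<times> A" g] sp(1)[OF xs] g(2) by blast
    qed
    ultimately show ?case by blast
  qed
  then have "\<forall>n. \<exists>f. inj_on f {xs \<in> lists A. length xs = n} \<and> f ` {xs \<in> lists A. length xs = n} \<subseteq> A"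
    by (rule allI)
  from choice[OF this] obtain f where
    "\<forall>n. inj_on (f n) {xs \<in> lists A. length xs = n} \<and> f n ` {xs \<in> lists A. length xs = n} \<subseteq> A"
    by (rule exE)
  then have f: "inj_on (f n) {xs \<in> lists A. length xs = n}"
    "f n ` {xs \<in> lists A. length xs = n} \<subseteq> A" for n
    by simp_all
  have "inj_on (\<lambda>xs. (length xs, f (length xs) xs)) (lists A)"
  proof (rule inj_onI)
    fix xs ys assume "xs \<in> lists A" "ys \<in> lists A"
      "(length xs, f (length xs) xs) = (length ys, f (length ys) ys)"
    then show "xs = ys" using inj_onD[OF f(1)[of "length ys"], of xs ys] by auto
  qed
  moreover have "(\<lambda>xs. (length xs, f (length xs) xs)) ` lists A \<subseteq> UNIV \<times> A"
    using f(2) by blast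
  ultimately have "lists A \<lesssim> (UNIV :: nat set) \<times> A" unfolding lepoll_def by blast
  also have "\<dots> \<lesssim> A \<times> A"
    using assms by (intro times_lepoll_mono lepoll_refl) (simp add: infinite_le_lepoll)
  also have "\<dots> \<lesssim> A" by (rule infinite_times_lepoll[OF assms])
  finally show ?thesis .
qed

lemma finite_set_tm: "finite (set_tm t)"
  by (induction t) auto

text \<open>Every term arises from a shape by substituting entries of a list of parameters. There are only
  countably many shapes, so statements about all terms reduce to statements about lists.\<close>

lemma tm_shape:
  obtains s :: "nat tm" and l where "t = map_tm (\<lambda>i. l ! i) s" "set l = set_tm t"
proof -
  obtain l where l: "set l = set_tm t" by (metis finite_list finite_set_tm)
  define ix where "ix x = (SOME i. i < length l \<and> l ! i = x)" for x
  have "l ! ix x = x" if "x \<in> set_tm t" for x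
    using someI_ex[of "\<lambda>i. i < length l \<and> l ! i = x"] that l unfolding ix_def
    by (metis in_set_conv_nth)
  then have "map_tm (\<lambda>i. l ! i) (map_tm ix t) = t"
    by (simp add: tm.map_comp o_def tm.map_ident_strong)
  then show ?thesis using that l by metis
qed

lemma infinite_tms_lepoll:
  assumes "infinite A"
  shows "{t. set_tm t \<subseteq> A} \<lesssim> A"
proof -
  let ?g = "\<lambda>(s :: nat tm, l). map_tm (\<lambda>i. l ! i) s"
  have "{t. set_tm t \<subseteq> A} \<subseteq> ?g ` (UNIV \<times> lists A)"
  proof
    fix t assume "t \<in> {t. set_tm t \<subseteq> A}"
    then have t: "set_tm t \<subseteq> A" by simp
    obtain s :: "nat tm" and l where "t = map_tm (\<lambda>i. l ! i) s" "set l = set_tm t"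
      by (rule tm_shape)
    with t show "t \<in> ?g ` (UNIV \<times> lists A)"
      by (intro image_eqI[of _ _ "(s, l)"]) auto
  qed
  then have "{t. set_tm t \<subseteq> A} \<lesssim> (UNIV :: nat tm set) \<times> lists A"
    by (rule subset_image_lepoll)
  also have "(UNIV :: nat tm set) \<lesssim> (UNIV :: nat set)"
    unfolding lepoll_def by (intro exI[of _ to_nat]) auto
  then have "(UNIV :: nat tm set) \<times> lists A \<lesssim> A \<times> A"
    using assms infinite_le_lepoll times_lepoll_mono lepoll_trans infinite_lists_lepoll by metis
  also have "A \<times> A \<lesssim> A" by (rule infinite_times_lepoll[OF assms])
  finally show ?thesis .
qed

section \<open>Collapsing a small elementary substructure\<close>

text \<open>Satisfaction is invariant under isomorphism.\<close>

lemma satisfies_isomorphic: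
  assumes j: "bij_betw j M X" "\<And>x y. x \<in> M \<Longrightarrow> y \<in> M \<Longrightarrow> j x \<in> elts (j y) \<longleftrightarrow> x \<in> elts y"
  shows "range s \<subseteq> M \<Longrightarrow> satisfies M \<phi> s \<longleftrightarrow> satisfies X \<phi> (j \<circ> s)"
proof (induction \<phi> arbitrary: s)
  case (Member m n)
  then show ?case using j(2)[of "s m" "s n"] by auto
next
  case (Equal m n)
  then show ?case using inj_onD[OF bij_betw_imp_inj_on[OF j(1)], of "s m" "s n"] by auto
next
  case (Forall n \<phi>)
  have "satisfies M \<phi> (s(n := x)) \<longleftrightarrow> satisfies X \<phi> ((j \<circ> s)(n := j x))" if "x \<in> M" for x
  proof -
    have "range (s(n := x)) \<subseteq> M" using that Forall.prems by auto
    moreover have "j \<circ> s(n := x) = (j \<circ> s)(n := j x)" by auto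
    ultimately show ?thesis using Forall.IH by metis
  qed
  then show ?case
    unfolding satisfies.simps bij_betw_imp_surj_on[OF j(1), symmetric] by blast
qed auto

text \<open>The inverse of the transitive collapse of an elementary substructure is an elementary embedding.
  The substructure is extensional because the ambient class, being transitive, is: a difference between
  two elements is witnessed in \<open>H\<close>, hence in \<open>X\<close>.\<close>

lemma collapse_elementary:
  assumes trH: "transitive H" and X: "X \<subseteq> H" "small X"
    and el: "\<forall>\<phi> s. range s \<subseteq> X \<longrightarrow> satisfies X \<phi> s = satisfies H \<phi> s"
  defines "p \<equiv> collapse (mem_on X)" and "j \<equiv> inv_into X (collapse (mem_on X))"
    and "M \<equiv> vset (collapse (mem_on X) ` X)"
  shows "inj_on p X" "elts M = p ` X" "x \<in> X \<Longrightarrow> j (p x) = x"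
    "x \<in> X \<Longrightarrow> elts (p x) = p ` (elts x \<inter> X)" "Transset M" "elementary_embedding j (elts M) H"
proof -
  have e: "elts (p x) = p ` {y. (y, x) \<in> mem_on X}" for x
    unfolding p_def by (rule elts_collapse[OF wf_mem_on small_mem_on])
  then show ep: "elts (p x) = p ` (elts x \<inter> X)" if "x \<in> X" for x
    using that by (auto simp: mem_on_def)
  show inj: "inj_on p X"
    unfolding p_def
  proof (rule inj_on_collapse[OF wf_mem_on small_mem_on])
    show "mem_on X \<subseteq> X \<times> X" by (auto simp: mem_on_def)
    fix x y assume xy: "x \<in> X" "y \<in> X" and eq: "\<And>z. (z, x) \<in> mem_on X \<longleftrightarrow> (z, y) \<in> mem_on X"
    let ?\<phi> = "Forall 5 (FIff (Member 5 0) (Member 5 2))"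
    have "\<forall>z\<in>X. z \<in> elts x \<longleftrightarrow> z \<in> elts y" using eq xy by (auto simp: mem_on_def)
    then have "satisfies X ?\<phi> ((\<lambda>_. x)(2 := y))" by simp
    then have "satisfies H ?\<phi> ((\<lambda>_. x)(2 := y))"
      using el[rule_format, of "(\<lambda>_. x)(2 := y)" ?\<phi>] xy by auto
    then have "\<forall>z\<in>H. z \<in> elts x \<longleftrightarrow> z \<in> elts y" by simp
    then have "elts x = elts y"
      using transitiveD[OF trH] X(1) xy by blast
    then show "x = y" by (rule extensionality)
  qed
  show M: "elts M = p ` X" using X(2) by (simp add: M_def p_def)
  show jp: "j (p x) = x" if "x \<in> X" for x
    unfolding j_def p_def[symmetric] using inj that by (rule inv_into_f_f)
  show "Transset M"
    unfolding Transset_def M using ep by auto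
  have pm: "p x \<in> elts (p y) \<longleftrightarrow> x \<in> elts y" if "x \<in> X" "y \<in> X" for x y
    using ep[OF that(2)] inj that by (auto simp: inj_on_def)
  have bij: "bij_betw j (elts M) X"
    unfolding M by (rule bij_betw_byWitness[of _ p]) (use jp in auto)
  have jm: "j x \<in> elts (j y) \<longleftrightarrow> x \<in> elts y" if "x \<in> elts M" "y \<in> elts M" for x y
    using that pm jp unfolding M by auto
  show "elementary_embedding j (elts M) H"
    unfolding elementary_embedding_def
  proof (intro conjI allI impI)
    show "j ` elts M \<subseteq> H" using bij X(1) by (auto simp: bij_betw_def)
    fix \<phi> and s :: "nat \<Rightarrow> _" assume s: "range s \<subseteq> elts M"
    have "range (j \<circ> s) \<subseteq> X" using s bij by (auto simp: bij_betw_def)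
    then show "satisfies (elts M) \<phi> s = satisfies H \<phi> (j \<circ> s)"
      using satisfies_isomorphic[OF bij jm s] el by blast
  qed
qed

section \<open>Almost all sets in the sense of a normal ultrafilter\<close>

locale normal_measure =
  fixes \<kappa> \<mu> :: "'v::zfc_universe" and U :: "'v set set"
  assumes Card_\<kappa>: "Card \<kappa>" and Ord_\<mu>: "Ord \<mu>" and \<kappa>_le_\<mu>: "elts \<kappa> \<subseteq> elts \<mu>"
    and uncountable_\<kappa>: "uncountable (elts \<kappa>)"
    and ultrafilter: "ultrafilter_on (Pset \<kappa> \<mu>) U" and complete: "complete_family \<kappa> U"
    and fine: "fine_family \<kappa> \<mu> U" and normal: "normal_family \<kappa> \<mu> U"
begin

text \<open>\<open>U\<close> read as a quantifier over \<open>P\<^sub>\<kappa>(\<mu>)\<close>.\<close>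

definition almost_all :: "('v \<Rightarrow> bool) \<Rightarrow> bool" where
  "almost_all P \<longleftrightarrow> {a \<in> Pset \<kappa> \<mu>. P a} \<in> U"

lemma almost_all_mono:
  assumes "almost_all P" "\<And>a. a \<in> Pset \<kappa> \<mu> \<Longrightarrow> P a \<Longrightarrow> Q a"
  shows "almost_all Q"
proof -
  have "\<forall>X\<in>U. \<forall>Y. X \<subseteq> Y \<and> Y \<subseteq> Pset \<kappa> \<mu> \<longrightarrow> Y \<in> U"
    using ultrafilter unfolding ultrafilter_on_def by blast
  then show ?thesis
    using assms unfolding almost_all_def
    by (elim ballE[of _ _ "{a \<in> Pset \<kappa> \<mu>. P a}"] allE[of _ "{a \<in> Pset \<kappa> \<mu>. Q a}"]) auto
qed

lemma almost_all_conj: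
  assumes "almost_all P" "almost_all Q"
  shows "almost_all (\<lambda>a. P a \<and> Q a)"
proof -
  have "\<forall>X\<in>U. \<forall>Y\<in>U. X \<inter> Y \<in> U"
    using ultrafilter unfolding ultrafilter_on_def by blast
  then have "{a \<in> Pset \<kappa> \<mu>. P a} \<inter> {a \<in> Pset \<kappa> \<mu>. Q a} \<in> U"
    using assms unfolding almost_all_def by blast
  also have "{a \<in> Pset \<kappa> \<mu>. P a} \<inter> {a \<in> Pset \<kappa> \<mu>. Q a} = {a \<in> Pset \<kappa> \<mu>. P a \<and> Q a}" by blast
  finally show ?thesis unfolding almost_all_def .
qed

lemma almost_all_or_not: "almost_all P \<or> almost_all (\<lambda>a. \<not> P a)"
proof -
  have "X \<in> U \<or> Pset \<kappa> \<mu> - X \<in> U" if "X \<subseteq> Pset \<kappa> \<mu>" for X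
    using ultrafilter that unfolding ultrafilter_on_def by blast
  from this[of "{a \<in> Pset \<kappa> \<mu>. P a}"]
  have "{a \<in> Pset \<kappa> \<mu>. P a} \<in> U \<or> Pset \<kappa> \<mu> - {a \<in> Pset \<kappa> \<mu>. P a} \<in> U" by simp
  also have "Pset \<kappa> \<mu> - {a \<in> Pset \<kappa> \<mu>. P a} = {a \<in> Pset \<kappa> \<mu>. \<not> P a}" by blast
  finally show ?thesis unfolding almost_all_def .
qed

lemma almost_all_ex:
  assumes "almost_all P"
  obtains a where "a \<in> Pset \<kappa> \<mu>" "P a"
proof -
  have "{} \<notin> U" using ultrafilter unfolding ultrafilter_on_def by blast
  then have "{a \<in> Pset \<kappa> \<mu>. P a} \<noteq> {}" using assms unfolding almost_all_def by metis
  then show ?thesis using that by blast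
qed

lemma almost_all_True: "(\<And>a. a \<in> Pset \<kappa> \<mu> \<Longrightarrow> P a) \<Longrightarrow> almost_all P"
  using almost_all_or_not[of P] almost_all_ex by blast

lemma almost_all_mem: "\<gamma> \<in> elts \<mu> \<Longrightarrow> almost_all (\<lambda>a. \<gamma> \<in> elts a)"
  using fine unfolding fine_family_def almost_all_def by blast

lemma almost_all_INT:
  assumes "card_less I \<kappa>" "\<And>i. i \<in> I \<Longrightarrow> almost_all (P i)"
  shows "almost_all (\<lambda>a. \<forall>i\<in>I. P i a)"
proof (cases "I = {}")
  case False
  let ?F = "(\<lambda>i. {a \<in> Pset \<kappa> \<mu>. P i a}) ` I"
  have "card_less ?F \<kappa>"
    using card_less_mono[OF Card_Ord[OF Card_\<kappa>] assms(1) image_lepoll] .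
  moreover have "?F \<subseteq> U" using assms(2) unfolding almost_all_def by (rule image_subsetI)
  ultimately have "\<Inter>?F \<in> U"
    using complete[unfolded complete_family_def, rule_format, of ?F] False by simp
  also have "\<Inter>?F = {a \<in> Pset \<kappa> \<mu>. \<forall>i\<in>I. P i a}" using False by blast
  finally show ?thesis unfolding almost_all_def .
qed (simp add: almost_all_True)

lemma almost_all_countable:
  fixes P :: "'i::countable \<Rightarrow> 'v \<Rightarrow> bool"
  assumes "\<And>i. almost_all (P i)"
  shows "almost_all (\<lambda>a. \<forall>i. P i a)"
  using almost_all_INT[OF card_less_countable[OF Card_\<kappa> uncountable_\<kappa>, of "UNIV :: 'i set"], of P] assms
  by simp

text \<open>Closure under diagonal intersections, the dual form of normality: a choice of counterexamples
  would be regressive, hence almost always equal to one \<open>\<gamma>\<close>.\<close>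

lemma almost_all_diagonal:
  assumes "\<And>\<gamma>. \<gamma> \<in> elts \<mu> \<Longrightarrow> almost_all (P \<gamma>)"
  shows "almost_all (\<lambda>a. \<forall>\<gamma>\<in>elts a. P \<gamma> a)"
proof (rule ccontr)
  assume "\<not> ?thesis"
  then have bad: "almost_all (\<lambda>a. \<not> (\<forall>\<gamma>\<in>elts a. P \<gamma> a))"
    using almost_all_or_not by blast
  define f where "f a = (SOME \<gamma>. \<gamma> \<in> elts a \<and> \<not> P \<gamma> a)" for a
  have f: "f a \<in> elts a \<and> \<not> P (f a) a" if "\<not> (\<forall>\<gamma>\<in>elts a. P \<gamma> a)" for a
    unfolding f_def by (rule someI_ex) (use that in blast)
  have bad_f: "almost_all (\<lambda>a. f a \<in> elts a \<and> \<not> P (f a) a)"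
    by (rule almost_all_mono[OF bad f])
  then have "almost_all (\<lambda>a. f a \<in> elts a)"
    by (rule almost_all_mono) simp
  then obtain \<gamma> where \<gamma>: "\<gamma> \<in> elts \<mu>" "almost_all (\<lambda>a. f a = \<gamma>)"
    using normal unfolding normal_family_def almost_all_def by blast
  from almost_all_conj[OF almost_all_conj[OF bad_f \<gamma>(2)] assms[OF \<gamma>(1)]]
  show False by (rule almost_all_ex) blast
qed

text \<open>Diagonal intersections iterated along the list, for each of the countably many lengths.\<close>

lemma almost_all_lists:
  assumes "\<And>l. l \<in> lists (elts \<mu>) \<Longrightarrow> almost_all (P l)"
  shows "almost_all (\<lambda>a. \<forall>l\<in>lists (elts a). P l a)"
proof -
  have "almost_all (\<lambda>a. \<forall>l\<in>lists (elts a). length l = n \<longrightarrow> P l a)"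
    if "\<And>l. l \<in> lists (elts \<mu>) \<Longrightarrow> almost_all (P l)" for n P
    using that
  proof (induction n arbitrary: P)
    case 0
    from 0[of "[]"] show ?case by (rule almost_all_mono) auto
  next
    case (Suc n)
    have "almost_all (\<lambda>a. \<forall>l\<in>lists (elts a). length l = n \<longrightarrow> P (\<gamma> # l) a)" if "\<gamma> \<in> elts \<mu>" for \<gamma>
      by (rule Suc.IH) (use Suc.prems that in auto)
    then have "almost_all (\<lambda>a. \<forall>\<gamma>\<in>elts a. \<forall>l\<in>lists (elts a). length l = n \<longrightarrow> P (\<gamma> # l) a)"
      by (rule almost_all_diagonal)
    then show ?case
      by (rule almost_all_mono) (fastforce simp: length_Suc_conv)
  qed
  then have "almost_all (\<lambda>a. \<forall>n. \<forall>l\<in>lists (elts a). length l = n \<longrightarrow> P l a)"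
    using assms by (intro almost_all_countable) blast
  then show ?thesis by (rule almost_all_mono) blast
qed

lemma almost_all_tms:
  assumes "\<And>t. set_tm t \<subseteq> elts \<mu> \<Longrightarrow> almost_all (P t)"
  shows "almost_all (\<lambda>a. \<forall>t. set_tm t \<subseteq> elts a \<longrightarrow> P t a)"
proof -
  let ?t = "\<lambda>(s :: nat tm) l. map_tm (\<lambda>i. l ! i) s"
  have "almost_all (\<lambda>a. set_tm (?t s l) \<subseteq> elts a \<longrightarrow> P (?t s l) a)" for s l
  proof (cases "set_tm (?t s l) \<subseteq> elts \<mu>")
    case True
    from assms[OF this] show ?thesis by (rule almost_all_mono) simp
  next
    case False
    then show ?thesis by (intro almost_all_True) (auto simp: Pset_def)
  qed
  then have "almost_all (\<lambda>a. \<forall>s. \<forall>l\<in>lists (elts a). set_tm (?t s l) \<subseteq> elts a \<longrightarrow> P (?t s l) a)"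
    by (intro almost_all_countable almost_all_lists)
  then show ?thesis
  proof (rule almost_all_mono, intro allI impI)
    fix a t assume all: "\<forall>s. \<forall>l\<in>lists (elts a). set_tm (?t s l) \<subseteq> elts a \<longrightarrow> P (?t s l) a"
      and t: "set_tm t \<subseteq> elts a"
    obtain s :: "nat tm" and l where "t = ?t s l" "set l = set_tm t" by (rule tm_shape)
    with all t show "P t a" by (metis in_listsI subsetD)
  qed
qed

lemma almost_all_infinite: "almost_all (\<lambda>a. infinite (elts a))"
proof -
  have "infinite (elts \<mu>)"
    using uncountable_\<kappa> \<kappa>_le_\<mu> countable_finite finite_subset by blast
  then obtain f :: "nat \<Rightarrow> 'v" where f: "inj f" "range f \<subseteq> elts \<mu>"
    unfolding infinite_le_lepoll lepoll_def by blast
  have "almost_all (\<lambda>a. \<forall>n. f n \<in> elts a)"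
    by (rule almost_all_countable, rule almost_all_mem) (use f(2) in blast)
  then show ?thesis
  proof (rule almost_all_mono)
    fix a assume "\<forall>n. f n \<in> elts a"
    then have "range f \<subseteq> elts a" by blast
    then show "infinite (elts a)" using f(1) finite_imageD finite_subset infinite_UNIV_nat by blast
  qed
qed

text \<open>For a fixed \<open>\<gamma> < \<kappa>\<close> almost every \<open>a\<close> includes \<open>\<gamma>\<close>, by fineness and completeness; the diagonal
  intersection covers all \<open>\<gamma> \<in> a\<close>. So \<open>a \<inter> \<kappa>\<close> is almost always an ordinal.\<close>

lemma almost_all_initial: "almost_all (\<lambda>a. \<forall>\<gamma>\<in>elts a. \<gamma> \<in> elts \<kappa> \<longrightarrow> elts \<gamma> \<subseteq> elts a)"
proof (rule almost_all_diagonal)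
  fix \<gamma> assume "\<gamma> \<in> elts \<mu>"
  show "almost_all (\<lambda>a. \<gamma> \<in> elts \<kappa> \<longrightarrow> elts \<gamma> \<subseteq> elts a)"
  proof (cases "\<gamma> \<in> elts \<kappa>")
    case True
    then have "card_less (elts \<gamma>) \<kappa>" unfolding card_less_def by blast
    then have "almost_all (\<lambda>a. \<forall>\<beta>\<in>elts \<gamma>. \<beta> \<in> elts a)"
    proof (rule almost_all_INT, intro almost_all_mem)
      fix \<beta> assume "\<beta> \<in> elts \<gamma>"
      then show "\<beta> \<in> elts \<mu>" using Ord_trans[OF Ord_\<mu> \<open>\<gamma> \<in> elts \<mu>\<close>] by blast
    qed
    then show ?thesis by (rule almost_all_mono) blast
  qed (simp add: almost_all_True)
qed

text \<open>One sufficiently generic \<open>a \<in> P\<^sub>\<kappa>(\<mu>)\<close> yields the embedding, as the inverse of the collapse \<open>p\<close> of the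
  hull \<open>X\<close> of \<open>a \<union> {\<kappa>, \<mu>, W}\<close>.\<close>

lemma ex_small_embedding:
  assumes \<theta>: "Card \<theta>" "\<kappa> \<in> elts \<theta>"
    and powers: "elts (VPow (VPow (VPow (VPow \<mu>)))) \<subseteq> Hset \<theta>"
  shows "\<exists>M j \<delta>. small_embedding \<kappa> \<theta> M j \<and> \<delta> \<in> elts M \<inter> elts \<kappa> \<and> j \<delta> = \<mu> \<and>
    derived_family j M \<delta> \<in> elts ` elts M"
proof -
  let ?H = "Hset \<theta>"
  have Ord_\<theta>: "Ord \<theta>" and Ord_\<kappa>: "Ord \<kappa>" using \<theta>(1) Card_\<kappa> Card_Ord by auto
  have trH: "transitive ?H"
    unfolding transitive_def using Hset_mem[OF Ord_\<theta>] by blast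
  have T: "Transset \<mu>" "Transset (VPow \<mu>)" "Transset (VPow (VPow \<mu>))" "Transset (VPow (VPow (VPow \<mu>)))"
    using Ord_\<mu> Transset_VPow by (auto simp: Ord_def)
  \<comment> \<open>The code \<open>W\<close> of \<open>U\<close> is in the third power set of \<open>\<mu>\<close>.\<close>
  have H3: "elts (VPow (VPow (VPow \<mu>))) \<subseteq> ?H"
    using VPow_increasing[OF T(4)] powers by blast
  have H1: "elts (VPow \<mu>) \<subseteq> ?H"
    using VPow_increasing[OF T(2)] VPow_increasing[OF T(3)] H3 by blast
  have "U \<subseteq> Pow (Pset \<kappa> \<mu>)"
    using ultrafilter unfolding ultrafilter_on_def by (rule conjunct1)
  then have U_sub: "X \<subseteq> Pset \<kappa> \<mu>" if "X \<in> U" for X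
    using that by blast
  define W where "W = vset {z. elts z \<in> U}"
  have W_sub: "{z. elts z \<in> U} \<subseteq> elts (VPow (VPow \<mu>))"
  proof
    fix z assume "z \<in> {z. elts z \<in> U}"
    then have "elts z \<subseteq> Pset \<kappa> \<mu>" using U_sub by simp
    then have "elts z \<subseteq> elts (VPow \<mu>)" by (auto simp: Pset_def)
    then show "z \<in> elts (VPow (VPow \<mu>))" by simp
  qed
  then have W: "z \<in> elts W \<longleftrightarrow> elts z \<in> U" for z
    using small_subset[OF small_elts W_sub] by (simp add: W_def)
  have "W \<in> ?H"
  proof -
    have "W \<in> elts (VPow (VPow (VPow \<mu>)))" using W W_sub by auto
    then show ?thesis using H3 by blast
  qed
  moreover have "\<kappa> \<in> ?H" "\<mu> \<in> ?H" using \<kappa>_le_\<mu> H1 by auto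
  moreover have \<mu>_H: "elts \<mu> \<subseteq> ?H" using \<open>\<mu> \<in> ?H\<close> trH by (auto simp: transitive_def)
  moreover define k where "k = (\<lambda>i. if i = 0 then \<kappa> else if i = Suc 0 then \<mu> else W)"
  ultimately have k: "k i \<in> ?H" for i by auto
  let ?val = "val ?H k"
  have "almost_all (\<lambda>a. ?val t \<in> elts \<mu> \<longrightarrow> ?val t \<in> elts a)" for t
    by (cases "?val t \<in> elts \<mu>") (auto simp: almost_all_True almost_all_mem)
  then have closed_ae: "almost_all (\<lambda>a. \<forall>t. set_tm t \<subseteq> elts a \<longrightarrow> ?val t \<in> elts \<mu> \<longrightarrow> ?val t \<in> elts a)"
    by (rule almost_all_tms)
  have "almost_all (\<lambda>a. a \<in> elts (?val t) \<longleftrightarrow> almost_all (\<lambda>b. b \<in> elts (?val t)))" for t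
  proof (cases "almost_all (\<lambda>b. b \<in> elts (?val t))")
    case True
    then show ?thesis by simp
  next
    case False
    then have "almost_all (\<lambda>b. b \<notin> elts (?val t))"
      using almost_all_or_not by blast
    with False show ?thesis by simp
  qed
  then have generic_ae: "almost_all (\<lambda>a. \<forall>t. set_tm t \<subseteq> elts a \<longrightarrow>
      (a \<in> elts (?val t) \<longleftrightarrow> almost_all (\<lambda>b. b \<in> elts (?val t))))"
    by (rule almost_all_tms)
  obtain a where a: "a \<in> Pset \<kappa> \<mu>"
    and a_closed: "\<And>t. set_tm t \<subseteq> elts a \<Longrightarrow> ?val t \<in> elts \<mu> \<Longrightarrow> ?val t \<in> elts a"
    and a_generic: "\<And>t. set_tm t \<subseteq> elts a \<Longrightarrow> a \<in> elts (?val t) \<longleftrightarrow> almost_all (\<lambda>b. b \<in> elts (?val t))"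
    and a_initial: "\<And>\<gamma>. \<gamma> \<in> elts a \<Longrightarrow> \<gamma> \<in> elts \<kappa> \<Longrightarrow> elts \<gamma> \<subseteq> elts a"
    and a_inf: "infinite (elts a)"
    using almost_all_conj[OF almost_all_conj[OF closed_ae generic_ae]
        almost_all_conj[OF almost_all_initial almost_all_infinite]]
    by (rule almost_all_ex) blast
  from a have a_sub: "elts a \<subseteq> elts \<mu>" and a_card: "card_less (elts a) \<kappa>"
    by (auto simp: Pset_def)
  have aH: "elts a \<subseteq> ?H" using a_sub \<mu>_H by blast
  define X where "X = hull ?H k (elts a)"
  have XH: "X \<subseteq> ?H"
    unfolding X_def using k aH by (rule hull_subset)
  have X_le: "X \<lesssim> elts a"
    unfolding X_def hull_def using lepoll_trans[OF image_lepoll infinite_tms_lepoll[OF a_inf]] .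
  have el: "\<forall>\<phi> s. range s \<subseteq> X \<longrightarrow> satisfies X \<phi> s = satisfies ?H \<phi> s"
    unfolding X_def by (intro allI impI) (rule hull_elementary[OF k aH])
  have "k 0 \<in> X" "k (Suc 0) \<in> X" "k 2 \<in> X" unfolding X_def by (rule Con_in_hull)+
  then have k_X: "\<kappa> \<in> X" "\<mu> \<in> X" "W \<in> X" by (simp_all add: k_def)
  have X_val: "\<exists>t. set_tm t \<subseteq> elts a \<and> x = ?val t" if "x \<in> X" for x
    using that unfolding X_def hull_def by auto
  have X_\<mu>: "elts \<mu> \<inter> X = elts a"
  proof (intro equalityI subsetI)
    fix x assume "x \<in> elts \<mu> \<inter> X"
    with X_val[of x] a_closed show "x \<in> elts a" by auto
  next
    fix x assume "x \<in> elts a"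
    with a_sub Par_in_hull[of x "elts a"] show "x \<in> elts \<mu> \<inter> X" unfolding X_def by blast
  qed
  have X_generic: "a \<in> elts z \<longleftrightarrow> almost_all (\<lambda>b. b \<in> elts z)" if "z \<in> X" for z
    using X_val[OF that] a_generic by auto
  define p where "p = collapse (mem_on X)"
  define j where "j = inv_into X p"
  define M where "M = vset (p ` X)"
  note col = collapse_elementary[OF trH XH small_lepoll[OF X_le] el,
      folded p_def, folded j_def M_def]
  have jp: "j (p x) = x" if "x \<in> X" for x by (rule col(3)[OF that])
  have elts_p: "elts (p x) = p ` (elts x \<inter> X)" if "x \<in> X" for x by (rule col(4)[OF that])
  have M_X: "x \<in> elts M \<longleftrightarrow> x = p (j x) \<and> j x \<in> X" for x
    unfolding col(2) using jp by (auto simp: image_iff)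
  \<comment> \<open>The collapse is the identity on the initial segment \<open>a \<inter> \<kappa>\<close> of \<open>X \<inter> \<kappa>\<close>, so it maps \<open>\<kappa>\<close> to
    \<open>a \<inter> \<kappa>\<close>. This is a proper initial segment of \<open>\<kappa>\<close>, since \<open>a\<close> is too small to include \<open>\<kappa>\<close>.\<close>
  let ?c = "p \<kappa>"
  have X_\<kappa>: "elts \<kappa> \<inter> X = elts \<kappa> \<inter> elts a" using X_\<mu> \<kappa>_le_\<mu> by blast
  have p_id: "p \<gamma> = \<gamma>" if "\<gamma> \<in> elts \<kappa> \<inter> elts a" for \<gamma>
    using that
  proof (induction \<gamma> rule: mem_induct)
    case (mem \<gamma>)
    then have sub: "elts \<gamma> \<subseteq> elts \<kappa> \<inter> elts a"
      using a_initial Ord_trans[OF Ord_\<kappa>] by blast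
    moreover have "\<gamma> \<in> X" using mem.prems X_\<kappa> by blast
    ultimately have "elts (p \<gamma>) = p ` elts \<gamma>"
      using elts_p X_\<kappa> by (metis Int_absorb2 le_inf_iff)
    also have "\<dots> = elts \<gamma>" using mem.IH sub by force
    finally show ?case by (rule extensionality)
  qed
  have elts_c: "elts ?c = elts \<kappa> \<inter> elts a"
    unfolding elts_p[OF k_X(1)] X_\<kappa> using p_id by force
  have "Ord (vset (elts ?c))"
  proof (rule Ord_vset[OF small_elts])
    fix x assume x: "x \<in> elts ?c"
    then show "Ord x" using elts_c Ord_mem[OF Ord_\<kappa>] by blast
    fix y assume "y \<in> elts x"
    with x show "y \<in> elts ?c" unfolding elts_c using a_initial[of x] Ord_trans[OF Ord_\<kappa>, of x y] by blast
  qed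
  then have Ord_c: "Ord ?c" by simp
  obtain \<beta> where \<beta>: "\<beta> \<in> elts \<kappa>" "elts a \<approx> elts \<beta>"
    using a_card unfolding card_less_def by blast
  have not_le: "\<not> elts \<kappa> \<lesssim> elts a"
    using Card_not_lepoll_mem[OF Card_\<kappa> \<beta>(1)] lepoll_trans2[OF _ \<beta>(2)] by blast
  have "?c \<noteq> \<kappa>" using elts_c not_le by (metis inf_le2 subset_imp_lepoll)
  then have c_in_\<kappa>: "?c \<in> elts \<kappa>"
    using Ord_subset_mem[OF Ord_c Ord_\<kappa>] elts_c by blast
  have jc: "j ?c = \<kappa>" by (rule jp[OF k_X(1)])
  have c_M: "?c \<in> elts M" using k_X(1) by (auto simp: col(2))
  have crit: "crit j (elts M) = ?c"
  proof (rule crit_eqI[OF c_M Ord_c])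
    show "?c \<in> elts (j ?c)" using jc c_in_\<kappa> by simp
    fix \<beta> assume \<beta>: "\<beta> \<in> elts M" "Ord \<beta>" "\<beta> \<in> elts (j \<beta>)"
    show "elts ?c \<subseteq> elts \<beta>"
    proof (rule Ord_not_mem[OF \<beta>(2) Ord_c], rule notI)
      assume "\<beta> \<in> elts ?c"
      then have "\<beta> \<in> elts \<kappa> \<inter> elts a" using elts_c by simp
      then have "j \<beta> = \<beta>" using p_id jp[of \<beta>] X_\<kappa> by auto
      with \<beta>(3) mem_irrefl[of \<beta>] show False by simp
    qed
  qed
  \<comment> \<open>The collapse of \<open>\<mu>\<close> is the order type of \<open>X \<inter> \<mu> = a\<close>. It is below \<open>\<kappa>\<close> because it has the size
    of \<open>a\<close>.\<close>
  let ?\<delta> = "p \<mu>"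
  have elts_\<delta>: "elts ?\<delta> = p ` elts a" by (simp add: elts_p[OF k_X(2)] X_\<mu>)
  have aX: "elts a \<subseteq> X" using X_\<mu> by blast
  have j\<delta>: "j ` elts ?\<delta> = elts a"
    unfolding elts_\<delta> using aX jp by force
  have Ord_p: "Ord (p \<xi>)" if "\<xi> \<in> X" "Ord \<xi>" for \<xi>
    using that
  proof (induction \<xi> rule: mem_induct)
    case (mem \<xi>)
    have el: "elts (p \<xi>) = p ` (elts \<xi> \<inter> X)" by (rule elts_p[OF mem.prems(1)])
    have "Transset (p \<eta>)" if "\<eta> \<in> elts \<xi> \<inter> X" for \<eta>
      using mem.IH that Ord_mem[OF mem.prems(2)] by (auto simp: Ord_def)
    moreover have "elts (p \<eta>) \<subseteq> elts (p \<xi>)" if "\<eta> \<in> elts \<xi> \<inter> X" for \<eta>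
      unfolding el using elts_p[of \<eta>] that Ord_trans[OF mem.prems(2)] by auto
    ultimately show ?case unfolding Ord_def Transset_def[of "p \<xi>"] el by blast
  qed
  have Ord_\<delta>: "Ord ?\<delta>" by (rule Ord_p[OF k_X(2) Ord_\<mu>])
  have "elts ?\<delta> \<approx> elts a"
    unfolding elts_\<delta> using inj_on_subset[OF col(1) aX] by (rule inj_on_image_eqpoll_self)
  then have "\<not> elts \<kappa> \<lesssim> elts ?\<delta>" using not_le lepoll_trans2 by blast
  then have \<delta>_in_\<kappa>: "?\<delta> \<in> elts \<kappa>"
    using Ord_not_mem[OF Ord_\<delta> Ord_\<kappa>] subset_imp_lepoll by blast
  have \<delta>_M: "?\<delta> \<in> elts M" using k_X(2) by (auto simp: col(2))
  \<comment> \<open>Since \<open>j[\<delta>] = a\<close>, genericity of \<open>a\<close> turns membership of \<open>A\<close> in the derived family into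
    \<open>j(A) \<in> W\<close>.\<close>
  interpret transitive_embedding j "elts M" ?H
  proof
    show "transitive (elts M)" using col(5) by (auto simp: Transset_def transitive_def)
    show "y \<in> ?H" if "x \<in> ?H" "elts y \<subseteq> elts x" for x y
      by (rule Hset_subset[OF Ord_\<theta> that])
  qed (fact trH col(6))+
  have PH: "Pset_rel ?H \<kappa> \<mu> = Pset \<kappa> \<mu>"
    by (rule Pset_rel_eq_Pset[OF Ord_\<mu> \<kappa>_le_\<mu> H3])
  have j_M: "j A \<in> X" if "A \<in> elts M" for A using that M_X by blast
  have generic: "A \<in> derived_family j M ?\<delta> \<longleftrightarrow> A \<in> elts M \<and> j A \<in> elts W" for A
  proof (cases "A \<in> elts M")
    case True
    have "A \<in> PowPset_rel (elts M) ?c ?\<delta> \<longleftrightarrow> elts (j A) \<subseteq> Pset \<kappa> \<mu>"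
      using j_PowPset_rel_iff[OF True c_M \<delta>_M] jc jp[OF k_X(2)] j_in_H[OF True]
      by (simp add: PowPset_rel_def PH)
    moreover have "j ` elts ?\<delta> \<in> elts ` elts (j A) \<longleftrightarrow> a \<in> elts (j A)"
      unfolding j\<delta> using extensionality by (metis imageE image_eqI)
    moreover have "a \<in> elts (j A) \<longleftrightarrow> elts (j A) \<in> U" if "elts (j A) \<subseteq> Pset \<kappa> \<mu>"
    proof -
      have "{b \<in> Pset \<kappa> \<mu>. b \<in> elts (j A)} = elts (j A)" using that by blast
      then show ?thesis using X_generic[OF j_M[OF True]] by (simp add: almost_all_def)
    qed
    ultimately show ?thesis
      using True U_sub unfolding derived_family_def crit W by blast
  next
    case False
    then show ?thesis by (auto simp: derived_family_def PowPset_rel_def)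
  qed
  have "derived_family j M ?\<delta> = elts (p W)"
  proof (intro equalityI subsetI)
    fix A assume "A \<in> derived_family j M ?\<delta>"
    then have "A = p (j A)" "j A \<in> elts W \<inter> X" using generic M_X by auto
    then show "A \<in> elts (p W)" unfolding elts_p[OF k_X(3)] by blast
  next
    fix A assume "A \<in> elts (p W)"
    then show "A \<in> derived_family j M ?\<delta>"
      unfolding elts_p[OF k_X(3)] generic col(2) using jp by auto
  qed
  moreover have "p W \<in> elts M" using k_X(3) by (auto simp: col(2))
  moreover have "small_embedding \<kappa> \<theta> M j"
    unfolding small_embedding_def crit
  proof (intro conjI)
    show "M \<in> Hset \<theta>"
    proof -
      have "trcl M \<subseteq> elts M" by (rule trcl_subset[OF col(5)]) simp
      moreover have "elts M \<lesssim> elts \<beta>"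
        unfolding col(2) using image_lepoll[of p X] X_le \<beta>(2) lepoll_trans lepoll_trans2 by blast
      moreover have "\<beta> \<in> elts \<theta>" using Ord_trans[OF Ord_\<theta> \<theta>(2) \<beta>(1)] .
      ultimately show ?thesis
        unfolding Hset_def using card_less_lepoll[OF Ord_\<theta>] lepoll_trans subset_imp_lepoll by blast
    qed
    show "nontrivial j (elts M)"
      unfolding nontrivial_def using c_M Ord_c jc c_in_\<kappa> by auto
  qed (use Card_\<kappa> \<theta> col(5,6) jc in auto)
  ultimately show ?thesis using \<delta>_M \<delta>_in_\<kappa> jp[OF k_X(2)] by blast
qed

end

section \<open>The equivalence\<close>

theorem lemma6p3:
  fixes \<kappa> \<mu> :: "'v::zfc_universe"
  assumes "Card \<kappa>" and "Card \<mu>" and "elts \<kappa> \<subseteq> elts \<mu>"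
  shows "supercompact \<kappa> \<mu> \<longleftrightarrow>
    (\<exists>\<alpha>. Ord \<alpha> \<and> elts \<kappa> \<subseteq> elts \<alpha> \<and>
      (\<forall>\<theta>. Card \<theta> \<and> \<alpha> \<in> elts \<theta> \<longrightarrow>
        (\<exists>M j \<delta>. small_embedding \<kappa> \<theta> M j \<and> \<delta> \<in> elts M \<inter> elts \<kappa> \<and> j \<delta> = \<mu> \<and>
           derived_family j M \<delta> \<in> elts ` elts M)))"
    (is "_ \<longleftrightarrow> (\<exists>\<alpha>. Ord \<alpha> \<and> _ \<and> (\<forall>\<theta>. _ \<longrightarrow> ?small \<theta>))")
proof -
  let ?B = "VPow (VPow (VPow (VPow \<mu>)))"
  have Ord_\<kappa>: "Ord \<kappa>" and Ord_\<mu>: "Ord \<mu>" using assms Card_Ord by auto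
  have "Transset \<mu>" using Ord_\<mu> by (simp add: Ord_def)
  then have "Transset ?B" by (intro Transset_VPow)
  then have powers: "elts ?B \<subseteq> Hset \<theta>"
    if "Card \<theta>" "\<beta> \<in> elts \<theta>" "elts ?B \<lesssim> elts \<beta>" for \<theta> \<beta> :: 'v
    using elts_subset_Hset[OF _ Card_Ord[OF that(1)] that(2,3)] by blast
  show ?thesis
  proof
    assume "supercompact \<kappa> \<mu>"
    then obtain U where "uncountable (elts \<kappa>)" "ultrafilter_on (Pset \<kappa> \<mu>) U"
      "complete_family \<kappa> U" "fine_family \<kappa> \<mu> U" "normal_family \<kappa> \<mu> U"
      unfolding supercompact_def by (elim conjE exE)
    then interpret normal_measure \<kappa> \<mu> U
      using assms Ord_\<mu> by unfold_locales
    obtain \<alpha> :: 'v where \<alpha>: "Ord \<alpha>" "elts ?B \<lesssim> elts \<alpha>" "elts \<kappa> \<subseteq> elts \<alpha>"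
      using Ord_above[OF Ord_\<kappa>, of ?B] by metis
    have "?small \<theta>" if "Card \<theta> \<and> \<alpha> \<in> elts \<theta>" for \<theta>
    proof (rule ex_small_embedding)
      show "Card \<theta>" using that by (rule conjunct1)
      show "\<kappa> \<in> elts \<theta>"
        using Ord_subset_mem_trans[OF Ord_\<kappa> _ \<alpha>(3)] Card_Ord that by metis
      show "elts ?B \<subseteq> Hset \<theta>" using powers \<alpha>(2) that by metis
    qed
    with \<alpha> show "\<exists>\<alpha>. Ord \<alpha> \<and> elts \<kappa> \<subseteq> elts \<alpha> \<and> (\<forall>\<theta>. Card \<theta> \<and> \<alpha> \<in> elts \<theta> \<longrightarrow> ?small \<theta>)"
      by metis
  next
    assume "\<exists>\<alpha>. Ord \<alpha> \<and> elts \<kappa> \<subseteq> elts \<alpha> \<and> (\<forall>\<theta>. Card \<theta> \<and> \<alpha> \<in> elts \<theta> \<longrightarrow> ?small \<theta>)"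
    then obtain \<alpha> where \<alpha>: "Ord \<alpha>"
      and small: "\<And>\<theta>. Card \<theta> \<and> \<alpha> \<in> elts \<theta> \<Longrightarrow> ?small \<theta>" by metis
    obtain \<beta> :: 'v where \<beta>: "Ord \<beta>" "elts ?B \<lesssim> elts \<beta>" "elts \<alpha> \<subseteq> elts \<beta>"
      using Ord_above[OF \<alpha>, of ?B] by metis
    obtain \<theta> where \<theta>: "Card \<theta>" "\<beta> \<in> elts \<theta>"
      using Card_above[OF \<beta>(1)] by metis
    have "\<alpha> \<in> elts \<theta>"
      using Ord_subset_mem_trans[OF \<alpha> Card_Ord[OF \<theta>(1)] \<beta>(3) \<theta>(2)] .
    then have "?small \<theta>" using small \<theta>(1) by simp
    then obtain M j \<delta> where "small_embedding \<kappa> \<theta> M j" "\<delta> \<in> elts M \<inter> elts \<kappa>" "j \<delta> = \<mu>"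
      "derived_family j M \<delta> \<in> elts ` elts M" by (elim exE conjE)
    moreover from this(4) obtain D where "D \<in> elts M" "derived_family j M \<delta> = elts D"
      by (rule imageE)
    ultimately interpret reflecting_embedding \<kappa> \<mu> \<theta> M \<delta> D j
      using assms powers[OF \<theta> \<beta>(2)] by unfold_locales auto
    show "supercompact \<kappa> \<mu>" by (rule supercompact_reflected)
  qed
qed

end
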